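(* Let $n\ge 4$, let $T_n$ be the set of all transpositions of the symmetric group $S_n$, and let $D'$ be the $(n-1)$-dimensional irreducible representation of $S_n$ corresponding to the partition $(n-1,1)$. Then $$\kappa_{S_n}(T_n,D')<\kappa_{S_n}(T_n)=\frac{2}{\sqrt{n-1}} .$$
   Context: The representation $D'$ can be realized as the restriction of the permutation representation of $S_n$ on $\mathbb{C}^n$ (with $\pi e_k=e_{\pi(k)}$ and the standard Hermitian inner product) to the invariant subspace of vectors orthogonal to $\sum_{k=1}^n e_k$. WARNING on notation: although $D'$ is a single irreducible representation, the quantity $\kappa_{S_n}(T_n)$ below is a minimum over all representations without invariant vectors, defined as follows. For a finite group $G$, let $G^*_0$ be the set of all (not necessarily finite-dimensional) unitary representations $(R,V)$ of $G$ on a nonzero complex Hilbert space $V$ having no nonzero invariant vector. For a generating set $Q$ of $G$ and $(R,V)\in G_0^*$, the Kazhdan constant associated with $(Q,R)$ is $$\kappa_G(Q,R):=\inf_{v\in V:\ \|v\|=1}\ \max_{q\in Q}\|R(q)v-v\|,$$ and the Kazhdan constant of $Q$ is $$\kappa_G(Q):=\inf_{R\in G_0^*}\kappa_G(Q,R).$$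
   Formalization: The strict inequality is reversed: what is proved is κ(T_n) = 2/√(n−1) < κ(T_n, D'). The printed direction is false for every n ≥ 4, since κ(T_n) is an infimum over a class of representations containing D'. *)

theory Defs
  imports Complex_Main "HOL-Algebra.Sym_Groups" "HOL-Algebra.Group_Action"
    "HOL-Algebra.Module" "HOL-Algebra.Algebraic_Closure_Type"
begin

section \<open>Complex Hilbert spaces\<close>

text \<open>
  The carrier is a subset of the ambient type \<open>'v\<close>, so that spaces and representations can be
  collected in a set. The fields \<open>mult\<close> and \<open>one\<close>, which \<open>module\<close> inherits from \<open>ring\<close>, play no
  role.
\<close>

record 'v hilbert = "(complex, 'v) module" +
  cinner :: "'v \<Rightarrow> 'v \<Rightarrow> complex"

definition hnorm :: "'v hilbert \<Rightarrow> 'v \<Rightarrow> real" where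
  "hnorm V v = sqrt (Re (cinner V v v))"

text \<open>The inner product is linear in the first argument.\<close>

locale hilbert_space = Module.module "ring_of_type_algebra :: complex ring" V
  for V :: "'v hilbert" (structure) +
  assumes cinner_add_left:
      "\<lbrakk>x \<in> carrier V; y \<in> carrier V; z \<in> carrier V\<rbrakk>
        \<Longrightarrow> cinner V (x \<oplus> y) z = cinner V x z + cinner V y z"
    and cinner_smult_left:
      "\<lbrakk>x \<in> carrier V; y \<in> carrier V\<rbrakk> \<Longrightarrow> cinner V (a \<odot> x) y = a * cinner V x y"
    and cinner_commute:
      "\<lbrakk>x \<in> carrier V; y \<in> carrier V\<rbrakk> \<Longrightarrow> cinner V y x = cnj (cinner V x y)"
    and cinner_pos:
      "\<lbrakk>x \<in> carrier V; x \<noteq> \<zero>\<rbrakk> \<Longrightarrow> 0 < Re (cinner V x x)"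
    and complete:
      "\<lbrakk>\<And>k. s k \<in> carrier V;
        \<And>e. e > 0 \<Longrightarrow> \<exists>N. \<forall>j\<ge>N. \<forall>k\<ge>N. hnorm V (s j \<ominus> s k) < e\<rbrakk>
        \<Longrightarrow> \<exists>l\<in>carrier V. (\<lambda>k. hnorm V (s k \<ominus> l)) \<longlonglongrightarrow> 0"


section \<open>Unitary representations and Kazhdan constants\<close>

text \<open>
  A \<open>group_action\<close> is by bijections of the carrier; together with linearity and invariance of
  the inner product it is an action by unitary operators.
\<close>

locale unitary_rep = hilbert_space V + group_action G "carrier V" R
  for G :: "'g monoid" and V :: "'v hilbert" and R :: "'g \<Rightarrow> 'v \<Rightarrow> 'v" +
  assumes rep_add:
      "\<lbrakk>g \<in> carrier G; x \<in> carrier V; y \<in> carrier V\<rbrakk>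
        \<Longrightarrow> R g (x \<oplus>\<^bsub>V\<^esub> y) = R g x \<oplus>\<^bsub>V\<^esub> R g y"
    and rep_smult:
      "\<lbrakk>g \<in> carrier G; x \<in> carrier V\<rbrakk> \<Longrightarrow> R g (a \<odot>\<^bsub>V\<^esub> x) = a \<odot>\<^bsub>V\<^esub> R g x"
    and rep_cinner:
      "\<lbrakk>g \<in> carrier G; x \<in> carrier V; y \<in> carrier V\<rbrakk>
        \<Longrightarrow> cinner V (R g x) (R g y) = cinner V x y"

definition reps_without_invariants :: "'g monoid \<Rightarrow> ('v hilbert \<times> ('g \<Rightarrow> 'v \<Rightarrow> 'v)) set" where
  "reps_without_invariants G =
    {(V, R). unitary_rep G V R \<and> carrier V \<noteq> {\<zero>\<^bsub>V\<^esub>} \<and>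
      (\<forall>v\<in>carrier V. (\<forall>g\<in>carrier G. R g v = v) \<longrightarrow> v = \<zero>\<^bsub>V\<^esub>)}"

text \<open>\<open>Q\<close> is meant to be finite and nonempty, and \<open>V\<close> nonzero.\<close>

definition kazhdan_rep :: "'g set \<Rightarrow> 'v hilbert \<Rightarrow> ('g \<Rightarrow> 'v \<Rightarrow> 'v) \<Rightarrow> real" where
  "kazhdan_rep Q V R =
    (INF v \<in> {v \<in> carrier V. hnorm V v = 1}. MAX q\<in>Q. hnorm V (R q v \<ominus>\<^bsub>V\<^esub> v))"

text \<open>
  HOL cannot quantify over all types inside a term, so the infimum ranges over the
  representations whose space has its carrier inside the type \<open>'v\<close>. Statements about this
  constant are to be polymorphic in \<open>'v\<close>. If \<open>'v\<close> has fewer elements than \<open>complex\<close>,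
  there is no nonzero complex Hilbert space inside it and the infimum is over the empty set.
\<close>

definition kazhdan_constant :: "'v itself \<Rightarrow> 'g monoid \<Rightarrow> 'g set \<Rightarrow> real" where
  "kazhdan_constant (_ :: 'v itself) G Q =
    (INF (V, R) \<in> (reps_without_invariants G :: ('v hilbert \<times> ('g \<Rightarrow> 'v \<Rightarrow> 'v)) set).
      kazhdan_rep Q V R)"


section \<open>The symmetric group\<close>

definition transpositions :: "nat \<Rightarrow> (nat \<Rightarrow> nat) set" where
  "transpositions n = {Transposition.transpose i j | i j. i \<in> {1..n} \<and> j \<in> {1..n} \<and> i \<noteq> j}"

text \<open>\<open>\<complex>\<^sup>n\<close>, as the functions supported on \<open>{1..n}\<close>, with the standard inner product.\<close>

definition Cn :: "nat \<Rightarrow> (nat \<Rightarrow> complex) hilbert" where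
  "Cn n = \<lparr>carrier = {x. \<forall>k. k \<notin> {1..n} \<longrightarrow> x k = 0},
    monoid.mult = undefined, one = undefined,
    ring.zero = (\<lambda>k. 0), add = (\<lambda>x y k. x k + y k),
    module.smult = (\<lambda>a x k. a * x k),
    cinner = (\<lambda>x y. \<Sum>k=1..n. x k * cnj (y k))\<rparr>"

definition standard_space :: "nat \<Rightarrow> (nat \<Rightarrow> complex) hilbert" where
  "standard_space n = (Cn n)\<lparr>carrier :=
    {x \<in> carrier (Cn n). cinner (Cn n) x (\<lambda>k. if k \<in> {1..n} then 1 else 0) = 0}\<rparr>"

text \<open>
  The representation on \<open>standard_space n\<close> of type \<open>(n - 1, 1)\<close>: the inverse below comes from
  the convention that \<open>p\<close> maps the basis vector \<open>e\<^sub>k\<close> to the basis vector with index \<open>p k\<close>.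
\<close>

definition standard_rep :: "nat \<Rightarrow> (nat \<Rightarrow> nat) \<Rightarrow> (nat \<Rightarrow> complex) \<Rightarrow> (nat \<Rightarrow> complex)" where
  "standard_rep n p = (\<lambda>x \<in> carrier (standard_space n). \<lambda>k. x (Hilbert_Choice.inv p k))"

end

theory Submission
  imports Defs
begin

text \<open>
  Write \<open>\<Delta> = \<Sum>\<^sub>\<tau> (1 - \<tau>)\<close>, summed over the transpositions. For a unit vector \<open>v\<close> of a unitary
  representation the mean of \<open>\<parallel>\<tau> v - v\<parallel>\<^sup>2\<close> over the \<open>n (n - 1) / 2\<close> transpositions is
  \<open>4 \<langle>\<Delta> v, v\<rangle> / (n (n - 1))\<close>, and the largest displacement is at least the mean. On
  representations without invariant vectors \<open>\<Delta>\<close> is bounded below by \<open>n\<close>, whence the lower bound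
  \<open>2 / sqrt (n - 1)\<close>. Equality needs two things at once: \<open>\<langle>\<Delta> v, v\<rangle> = n\<close>, which holds in
  multiples of the standard representation, and all displacements equal. A vector in a multiple
  \<open>D' \<otimes> H\<close> is a configuration of \<open>n\<close> points in \<open>H\<close> with centroid \<open>0\<close>, and \<open>(a b)\<close> displaces it by
  \<open>sqrt 2\<close> times the distance of the points \<open>a\<close> and \<open>b\<close>. So the bound is attained exactly by regular
  simplices: there is one with \<open>n\<close> vertices in \<open>\<complex>\<^sup>n\<close>, but for \<open>n \<ge> 4\<close> none in the plane \<open>\<complex>\<close>, which
  is the case of \<open>D'\<close> itself.

  The spectral gap (\<open>poincare_permutations\<close>) is proved by induction on \<open>n\<close>, with no
  classification of the irreducible representations: \<open>\<Delta>\<close> is, up to a factor, the sum over all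
  points of the corresponding operators of the point stabilisers, and the error is the sum of the
  projections onto the functions that depend on one value of the permutation only; on
  functions of mean zero that sum has norm \<open>n / (n - 1)\<close> (\<open>fibre_mean_bound\<close>). The inequality is
  proved for real functions on the symmetric group; it passes to an orbit in a Hilbert space because a finite family of vectors has, up to
  isometry, finitely many real coordinates (\<open>gram_coordinates\<close>), and each coordinate of the
  orbit map is such a function.

  The strict inequality is quantitative: for points \<open>z\<^sub>i\<close> of the plane with centroid \<open>0\<close> and moment of
  inertia \<open>1\<close>, the second moment of the squared distances is so large that some squared distance is
  at least \<open>3 / n\<close> (\<open>planar_max_distance\<close>). Thus the constant of the standard representation is at
  least \<open>sqrt (6 / n)\<close>, which exceeds \<open>2 / sqrt (n - 1)\<close> precisely when \<open>n > 3\<close>.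

  The equality case lives in the \<open>n \<times> n\<close> matrices with zero column sums, the rows being permuted. Such
  matrices have finitely many complex entries, so the space has a copy in any type that
  contains a copy of \<open>\<complex>\<close>.
\<close>

section \<open>A spectral gap for transpositions\<close>

lemma permutes_fibre:
  fixes A :: "'a set"
  assumes "k \<in> A" "i \<in> A"
  shows "bij_betw (\<lambda>q. Transposition.transpose k i \<circ> q)
           {q. q permutes (A - {k})} {p. p permutes A \<and> p k = i}"
proof (rule bij_betw_byWitness[where f' = "\<lambda>p. Transposition.transpose k i \<circ> p"])
  let ?t = "Transposition.transpose k i"
  have t: "?t permutes A" using assms by (simp add: permutes_swap_id)
  show "\<forall>q\<in>{q. q permutes (A - {k})}. ?t \<circ> (?t \<circ> q) = q"
    by (simp add: fun_eq_iff)
  show "\<forall>p\<in>{p. p permutes A \<and> p k = i}. ?t \<circ> (?t \<circ> p) = p"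
    by (simp add: fun_eq_iff)
  show "(\<lambda>q. ?t \<circ> q) ` {q. q permutes (A - {k})} \<subseteq> {p. p permutes A \<and> p k = i}"
  proof clarsimp
    fix q assume q: "q permutes (A - {k})"
    have "q permutes A" using q by (rule permutes_subset) auto
    moreover have "q k = k" using q by (simp add: permutes_def)
    ultimately show "?t \<circ> q permutes A \<and> ?t (q k) = i"
      using t permutes_compose by fastforce
  qed
  show "(\<lambda>p. ?t \<circ> p) ` {p. p permutes A \<and> p k = i} \<subseteq> {q. q permutes (A - {k})}"
  proof clarsimp
    fix p assume p: "p permutes A" "i = p k"
    have "Transposition.transpose k (p k) \<circ> p permutes A" using t p permutes_compose by fastforce
    then show "Transposition.transpose k (p k) \<circ> p permutes (A - {k})"
      by (rule permutes_superset) auto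
  qed
qed

lemma sum_permutes_fibre:
  fixes h :: "('a \<Rightarrow> 'a) \<Rightarrow> real"
  assumes "k \<in> A" "i \<in> A"
  shows "(\<Sum>p | p permutes A \<and> p k = i. h p)
       = (\<Sum>q | q permutes (A - {k}). h (Transposition.transpose k i \<circ> q))"
  by (rule sum.reindex_bij_betw[OF permutes_fibre[OF assms], symmetric])

lemma sum_permutes_split:
  fixes h :: "('a \<Rightarrow> 'a) \<Rightarrow> real"
  assumes "finite A" "k \<in> A"
  shows "(\<Sum>p | p permutes A. h p) = (\<Sum>i\<in>A. \<Sum>p | p permutes A \<and> p k = i. h p)"
proof -
  have "(\<Sum>i\<in>A. sum h {p \<in> {p. p permutes A}. p k = i}) = sum h {p. p permutes A}"
    by (rule sum.group) (use assms in \<open>auto simp: finite_permutations permutes_in_image\<close>)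
  then show ?thesis by simp
qed

lemma card_permutes_fibre:
  assumes "finite A" "k \<in> A" "i \<in> A"
  shows "card {p. p permutes A \<and> p k = i} = fact (card A - 1)"
  using bij_betw_same_card[OF permutes_fibre[OF assms(2,3)]] assms
  by (simp add: card_permutations)

lemma sum_permutes_apply:
  fixes h :: "'a \<Rightarrow> real"
  assumes "finite A" "k \<in> A"
  shows "(\<Sum>p | p permutes A. h (p k)) = fact (card A - 1) * (\<Sum>i\<in>A. h i)"
  unfolding sum_permutes_split[OF assms]
  by (simp add: sum_distrib_left card_permutes_fibre assms)

text \<open>
  The left-hand sum is the same for every \<open>l \<noteq> k\<close>, and for any permutation the values
  \<open>H (p l)\<close> with \<open>l \<noteq> k\<close> add up to \<open>- H (p k)\<close>.
\<close>

lemma sum_permutes_apply2: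
  fixes G H :: "'a \<Rightarrow> real"
  assumes A: "finite A" "k \<in> A" "l \<in> A" "k \<noteq> l"
    and G: "sum G A = 0" and H: "sum H A = 0"
  shows "real (card A - 1) * (\<Sum>p | p permutes A. G (p k) * H (p l))
       = - (fact (card A - 1) * (\<Sum>i\<in>A. G i * H i))"
proof -
  let ?P = "{p. p permutes A}"
  have same: "(\<Sum>p\<in>?P. G (p k) * H (p m)) = (\<Sum>p\<in>?P. G (p k) * H (p l))" if "m \<in> A - {k}" for m
  proof -
    have "bij_betw (\<lambda>p. p \<circ> Transposition.transpose l m) ?P ?P"
      by (rule bij_betw_byWitness[where f' = "\<lambda>p. p \<circ> Transposition.transpose l m"])
        (use that A in \<open>auto simp: fun_eq_iff permutes_swap_id intro!: permutes_compose\<close>)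
    from sum.reindex_bij_betw[OF this, of "\<lambda>p. G (p k) * H (p m)"]
    moreover have "k \<noteq> m" using that by auto
    ultimately show ?thesis using A(4) by (simp add: transpose_def)
  qed
  have "real (card A - 1) * (\<Sum>p\<in>?P. G (p k) * H (p l))
      = (\<Sum>m\<in>A - {k}. \<Sum>p\<in>?P. G (p k) * H (p m))"
  proof -
    have "(\<Sum>m\<in>A - {k}. \<Sum>p\<in>?P. G (p k) * H (p m)) = (\<Sum>m\<in>A - {k}. \<Sum>p\<in>?P. G (p k) * H (p l))"
      by (rule sum.cong[OF refl same])
    then show ?thesis using A by simp
  qed
  also have "\<dots> = (\<Sum>p\<in>?P. G (p k) * (\<Sum>m\<in>A - {k}. H (p m)))"
    by (subst sum.swap) (simp add: sum_distrib_left)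
  also have "\<dots> = (\<Sum>p\<in>?P. - (G (p k) * H (p k)))"
  proof (rule sum.cong, rule refl)
    fix p assume "p \<in> ?P"
    then have "bij_betw p A A" by (simp add: permutes_imp_bij)
    from sum.reindex_bij_betw[OF this, of H] have "(\<Sum>m\<in>A. H (p m)) = 0" using H by simp
    then have "(\<Sum>m\<in>A - {k}. H (p m)) = - H (p k)"
      using A by (simp add: sum_diff1)
    then show "G (p k) * (\<Sum>m\<in>A - {k}. H (p m)) = - (G (p k) * H (p k))" by simp
  qed
  also have "\<dots> = - (fact (card A - 1) * (\<Sum>i\<in>A. G i * H i))"
    using sum_permutes_apply[OF A(1,2), of "\<lambda>i. G i * H i"] by (simp add: sum_negf)
  finally show ?thesis .
qed

definition fibre_mean :: "'a set \<Rightarrow> (('a \<Rightarrow> 'a) \<Rightarrow> real) \<Rightarrow> 'a \<Rightarrow> 'a \<Rightarrow> real" where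
  "fibre_mean A f k i = (\<Sum>p | p permutes A \<and> p k = i. f p) / fact (card A - 1)"

text \<open>
  The functions \<open>p \<mapsto> F (p k)\<close> form for each \<open>k\<close> a subspace, and \<open>p \<mapsto> fibre_mean A f k (p k)\<close> is the
  projection of \<open>f\<close> to it. Distinct subspaces are not orthogonal, but on mean-zero functions nearly
  so: the projections \<open>P\<^sub>k\<close> satisfy \<open>(\<Sum>\<^sub>k P\<^sub>k)\<^sup>2 = (n / (n - 1)) \<Sum>\<^sub>k P\<^sub>k\<close>. Hence \<open>Q = ((n - 1) / n) \<Sum>\<^sub>k P\<^sub>k\<close>
  is again a projection, and the claim is \<open>\<langle>f, Q f\<rangle> \<le> \<parallel>f\<parallel>\<^sup>2\<close>.
\<close>

lemma fibre_mean_bound: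
  fixes f :: "('a \<Rightarrow> 'a) \<Rightarrow> real"
  assumes A: "finite A" "2 \<le> card A" and f: "(\<Sum>p | p permutes A. f p) = 0"
  shows "real (card A - 1) * (fact (card A - 1) * (\<Sum>k\<in>A. \<Sum>i\<in>A. (fibre_mean A f k i)\<^sup>2))
       \<le> real (card A) * (\<Sum>p | p permutes A. (f p)\<^sup>2)"
proof -
  let ?P = "{p. p permutes A}" and ?c = "fact (card A - 1) :: real" and ?n = "real (card A)"
  let ?F = "fibre_mean A f"
  define m where "m = real (card A - 1)"
  have m: "m > 0" "?n = m + 1" using A by (auto simp: m_def)
  define S where "S = ?c * (\<Sum>k\<in>A. \<Sum>i\<in>A. (?F k i)\<^sup>2)"
  define g where "g p = (\<Sum>k\<in>A. ?F k (p k))" for p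
  have fin: "finite ?P" using A by (simp add: finite_permutations)
  have S0: "S \<ge> 0" unfolding S_def by (intro mult_nonneg_nonneg sum_nonneg) auto
  have fib: "(\<Sum>p | p permutes A \<and> p k = i. f p) = ?c * ?F k i" for k i
    by (simp add: fibre_mean_def)
  have row: "(\<Sum>i\<in>A. ?F k i) = 0" if "k \<in> A" for k
    using sum_permutes_split[OF A(1) that, of f] f
    by (simp add: fibre_mean_def flip: sum_divide_distrib)
  have col: "(\<Sum>k\<in>A. ?F k i) = 0" if i: "i \<in> A" for i
  proof -
    have "(\<Sum>k\<in>A. \<Sum>p | p permutes A \<and> p k = i. f p) = (\<Sum>k\<in>A. \<Sum>p\<in>?P. if p k = i then f p else 0)"
      by (rule sum.cong, rule refl) (simp add: fin flip: sum.inter_filter)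
    also have "\<dots> = (\<Sum>p\<in>?P. \<Sum>k\<in>A. if p k = i then f p else 0)" by (rule sum.swap)
    also have "\<dots> = (\<Sum>p\<in>?P. f p)"
    proof (rule sum.cong, rule refl)
      fix p assume p: "p \<in> ?P"
      have "(\<Sum>k\<in>A. if p k = i then f p else 0) = (\<Sum>j\<in>A. if j = i then f p else 0)"
        using p by (intro sum.reindex_bij_betw[where h = p and g = "\<lambda>j. if j = i then f p else 0"])
            (simp add: permutes_imp_bij)
      then show "(\<Sum>k\<in>A. if p k = i then f p else 0) = f p" using A i by simp
    qed
    finally show ?thesis using f by (simp add: fibre_mean_def flip: sum_divide_distrib)
  qed
  have fg: "(\<Sum>p\<in>?P. f p * g p) = S"
  proof -
    have "(\<Sum>p\<in>?P. f p * g p) = (\<Sum>k\<in>A. \<Sum>p\<in>?P. f p * ?F k (p k))"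
      unfolding g_def sum_distrib_left by (rule sum.swap)
    also have "\<dots> = (\<Sum>k\<in>A. \<Sum>i\<in>A. \<Sum>p | p permutes A \<and> p k = i. f p * ?F k i)"
      by (intro sum.cong refl) (simp add: sum_permutes_split[OF A(1)])
    also have "\<dots> = S" unfolding S_def
      by (simp add: fib sum_distrib_left power2_eq_square mult.assoc flip: sum_distrib_right)
    finally show ?thesis .
  qed
  have gg: "m * (\<Sum>p\<in>?P. (g p)\<^sup>2) = ?n * S"
  proof -
    have pair: "m * (\<Sum>p\<in>?P. ?F k (p k) * ?F l (p l))
        = - (?c * (\<Sum>i\<in>A. ?F k i * ?F l i)) + (if l = k then ?n * (?c * (\<Sum>i\<in>A. ?F k i * ?F k i)) else 0)"
      if "k \<in> A" "l \<in> A" for k l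
    proof (cases "l = k")
      case True
      then show ?thesis
        using sum_permutes_apply[OF A(1) that(1), of "\<lambda>i. ?F k i * ?F k i"] m by (simp add: algebra_simps)
    next
      case False
      then show ?thesis using sum_permutes_apply2[OF A(1) that, of "?F k" "?F l"] row that
        by (simp add: m_def)
    qed
    have "m * (\<Sum>p\<in>?P. (g p)\<^sup>2) = (\<Sum>k\<in>A. \<Sum>l\<in>A. m * (\<Sum>p\<in>?P. ?F k (p k) * ?F l (p l)))"
      unfolding g_def power2_eq_square sum_product
      unfolding sum_distrib_left by (subst sum.swap, rule sum.cong, rule refl, rule sum.swap)
    also have "\<dots> = (\<Sum>k\<in>A. - (?c * (\<Sum>i\<in>A. ?F k i * (\<Sum>l\<in>A. ?F l i))) + ?n * (?c * (\<Sum>i\<in>A. ?F k i * ?F k i)))"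
    proof (rule sum.cong, rule refl)
      fix k assume k: "k \<in> A"
      have "(\<Sum>l\<in>A. \<Sum>i\<in>A. ?F k i * ?F l i) = (\<Sum>i\<in>A. ?F k i * (\<Sum>l\<in>A. ?F l i))"
        by (subst sum.swap) (simp add: sum_distrib_left)
      then have "(\<Sum>l\<in>A. - (?c * (\<Sum>i\<in>A. ?F k i * ?F l i))) = - (?c * (\<Sum>i\<in>A. ?F k i * (\<Sum>l\<in>A. ?F l i)))"
        by (simp only: sum_negf sum_distrib_left[symmetric])
      moreover have "(\<Sum>l\<in>A. m * (\<Sum>p\<in>?P. ?F k (p k) * ?F l (p l))) =
          (\<Sum>l\<in>A. - (?c * (\<Sum>i\<in>A. ?F k i * ?F l i)) + (if l = k then ?n * (?c * (\<Sum>i\<in>A. ?F k i * ?F k i)) else 0))"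
        by (rule sum.cong[OF refl pair[OF k]])
      moreover have "(\<Sum>l\<in>A. if l = k then ?n * (?c * (\<Sum>i\<in>A. ?F k i * ?F k i)) else 0) = ?n * (?c * (\<Sum>i\<in>A. ?F k i * ?F k i))"
        using k A(1) by simp
      ultimately show "(\<Sum>l\<in>A. m * (\<Sum>p\<in>?P. ?F k (p k) * ?F l (p l))) =
         - (?c * (\<Sum>i\<in>A. ?F k i * (\<Sum>l\<in>A. ?F l i))) + ?n * (?c * (\<Sum>i\<in>A. ?F k i * ?F k i))"
        by (simp only: sum.distrib)
    qed
    also have "\<dots> = ?n * S"
      by (simp add: col S_def power2_eq_square flip: sum_distrib_left)
    finally show ?thesis .
  qed
  \<comment> \<open>\<open>t * g\<close> is the projection of \<open>f\<close> to the span of all the subspaces, so expanding the square of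
    \<open>f - t * g\<close> is Bessel's inequality.\<close>
  define t where "t = m / ?n"
  have n0: "?n > 0" using m by simp
  have "0 \<le> (\<Sum>p\<in>?P. (f p - t * g p)\<^sup>2)" by (intro sum_nonneg) auto
  also have "\<dots> = (\<Sum>p\<in>?P. (f p)\<^sup>2) - 2 * t * (\<Sum>p\<in>?P. f p * g p) + t\<^sup>2 * (\<Sum>p\<in>?P. (g p)\<^sup>2)"
    by (simp add: power2_diff power_mult_distrib sum.distrib sum_subtractf sum_distrib_left mult_ac)
  also have "t\<^sup>2 * (\<Sum>p\<in>?P. (g p)\<^sup>2) = t * S"
  proof -
    have "t\<^sup>2 * (\<Sum>p\<in>?P. (g p)\<^sup>2) = t * (m * (\<Sum>p\<in>?P. (g p)\<^sup>2)) / ?n"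
      by (simp add: t_def power2_eq_square)
    then show ?thesis unfolding gg using n0 by simp
  qed
  finally have "t * S \<le> (\<Sum>p\<in>?P. (f p)\<^sup>2)" by (simp add: fg mult.commute)
  then have "m * S \<le> ?n * (\<Sum>p\<in>?P. (f p)\<^sup>2)"
    using n0 by (simp add: t_def field_simps)
  then show ?thesis by (simp add: S_def m_def)
qed

text \<open>
  The Dirichlet form of the walk on the permutations of \<open>A\<close> by right multiplication with
  transpositions. The sum runs over ordered pairs, so every transposition counts twice.
\<close>

definition transposition_energy :: "'a set \<Rightarrow> (('a \<Rightarrow> 'a) \<Rightarrow> real) \<Rightarrow> real" where
  "transposition_energy A f =
    (\<Sum>a\<in>A. \<Sum>b\<in>A. \<Sum>p | p permutes A. (f (p \<circ> Transposition.transpose a b) - f p)\<^sup>2)"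

text \<open>
  The left cosets of the stabiliser of \<open>k\<close> are the fibres of \<open>p \<mapsto> p k\<close>, and the moves inside a fibre
  are the transpositions that avoid \<open>k\<close>. A transposition avoids all but two points, whence the factor
  \<open>card A - 2\<close>.
\<close>

lemma energy_fibres:
  fixes f :: "('a \<Rightarrow> 'a) \<Rightarrow> real"
  assumes A: "finite A"
  shows "(\<Sum>k\<in>A. \<Sum>i\<in>A. transposition_energy (A - {k}) (\<lambda>q. f (Transposition.transpose k i \<circ> q)))
       = (real (card A) - 2) * transposition_energy A f"
proof -
  define h where "h a b = (\<Sum>p | p permutes A. (f (p \<circ> Transposition.transpose a b) - f p)\<^sup>2)" for a b
  have h0: "h a a = 0" for a by (simp add: h_def)
  have 1: "(\<Sum>i\<in>A. transposition_energy (A - {k}) (\<lambda>q. f (Transposition.transpose k i \<circ> q)))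
      = (\<Sum>a\<in>A - {k}. \<Sum>b\<in>A - {k}. h a b)" if k: "k \<in> A" for k
  proof -
    have "(\<Sum>i\<in>A. transposition_energy (A - {k}) (\<lambda>q. f (Transposition.transpose k i \<circ> q)))
      = (\<Sum>a\<in>A - {k}. \<Sum>b\<in>A - {k}. \<Sum>i\<in>A. \<Sum>q | q permutes (A - {k}).
            (f ((Transposition.transpose k i \<circ> q) \<circ> Transposition.transpose a b) - f (Transposition.transpose k i \<circ> q))\<^sup>2)"
      unfolding transposition_energy_def
      by (simp only: comp_assoc sum.swap[of _ "A - {k}" A])
    also have "\<dots> = (\<Sum>a\<in>A - {k}. \<Sum>b\<in>A - {k}. h a b)"
      unfolding h_def sum_permutes_split[OF A k]
      by (intro sum.cong refl sum_permutes_fibre[OF k, symmetric])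
    finally show ?thesis .
  qed
  have 2: "(\<Sum>a\<in>A - {k}. \<Sum>b\<in>A - {k}. h a b)
      = (\<Sum>a\<in>A. \<Sum>b\<in>A. h a b) - (\<Sum>b\<in>A. h k b) - (\<Sum>a\<in>A. h a k)" if k: "k \<in> A" for k
    using A k by (simp add: sum_diff1 sum_subtractf h0)
  have "(\<Sum>k\<in>A. \<Sum>i\<in>A. transposition_energy (A - {k}) (\<lambda>q. f (Transposition.transpose k i \<circ> q)))
     = (\<Sum>k\<in>A. (\<Sum>a\<in>A. \<Sum>b\<in>A. h a b) - (\<Sum>b\<in>A. h k b) - (\<Sum>a\<in>A. h a k))"
    by (intro sum.cong refl) (simp only: 1 2)
  also have "\<dots> = (real (card A) - 2) * (\<Sum>a\<in>A. \<Sum>b\<in>A. h a b)"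
    unfolding sum_subtractf sum.swap[of "\<lambda>k a. h a k" A A] by (simp add: left_diff_distrib)
  finally show ?thesis by (simp add: transposition_energy_def h_def)
qed

text \<open>
  The constant is sharp, and the induction reproduces it: for \<open>f\<close> of mean zero, the hypothesis for
  the fibres of all points, \<open>energy_fibres\<close> and \<open>fibre_mean_bound\<close> give
  \<open>(n - 2) E(f) \<ge> 4 (n - 1) (n - n / (n - 1)) \<parallel>f\<parallel>\<^sup>2 = 4 n (n - 2) \<parallel>f\<parallel>\<^sup>2\<close>. This says nothing for
  \<open>n = 2\<close>, which is therefore a base case.
\<close>

lemma poincare_permutations:
  fixes f :: "('a \<Rightarrow> 'a) \<Rightarrow> real"
  assumes "finite A"
  shows "4 * real (card A) * ((\<Sum>p | p permutes A. (f p)\<^sup>2) - (\<Sum>p | p permutes A. f p)\<^sup>2 / fact (card A))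
       \<le> transposition_energy A f"
  using assms
proof (induction "card A" arbitrary: A f rule: less_induct)
  case less
  let ?P = "{p. p permutes A}" and ?n = "real (card A)"
  have fin: "finite ?P" and cP: "card ?P = fact (card A)"
    using less.prems by (auto simp: finite_permutations card_permutations)
  have mean0: "4 * ?n * (\<Sum>p\<in>?P. (g p)\<^sup>2) \<le> transposition_energy A g"
    if g: "(\<Sum>p\<in>?P. g p) = 0" for g
  proof -
    consider "card A = 0" | "card A = 1" | "card A = 2" | "card A \<ge> 3" by linarith
    then show ?thesis
    proof cases
      case 1
      then show ?thesis by (simp add: transposition_energy_def sum_nonneg)
    next
      case 2
      then obtain a where "A = {a}" by (auto simp: card_1_singleton_iff)
      then show ?thesis using g by (simp add: transposition_energy_def)
    next
      case 3
      then obtain a b where ab: "A = {a, b}" "a \<noteq> b" by (auto simp: card_2_iff)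
      have P: "?P = {id, Transposition.transpose a b}"
        unfolding ab permutes_doubleton_iff by auto
      have ne: "id \<noteq> Transposition.transpose a b"
        using ab by (metis id_apply transpose_apply_first)
      have "g (Transposition.transpose a b) = - g id" using g ne unfolding P by simp
      then show ?thesis using ne ab 3 unfolding transposition_energy_def P
        by (simp add: power2_eq_square algebra_simps transpose_commute)
    next
      case 4
      let ?F = "fibre_mean A g" and ?c = "fact (card A - 1) :: real"
      have fib: "4 * (?n - 1) * ((\<Sum>p | p permutes A \<and> p k = i. (g p)\<^sup>2) - ?c * (?F k i)\<^sup>2)
          \<le> transposition_energy (A - {k}) (\<lambda>q. g (Transposition.transpose k i \<circ> q))"
        if ki: "k \<in> A" "i \<in> A" for k i
      proof -
        have c: "card (A - {k}) = card A - 1" using ki less.prems by simp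
        have "card (A - {k}) < card A" using ki(1) less.prems by (rule card_Diff1_less[rotated])
        from less.hyps[OF this, of "\<lambda>q. g (Transposition.transpose k i \<circ> q)"] less.prems
        show ?thesis using 4 unfolding c sum_permutes_fibre[OF ki] fibre_mean_def
          by (simp add: power2_eq_square of_nat_diff)
      qed
      have bnd: "(?n - 1) * (?c * (\<Sum>k\<in>A. \<Sum>i\<in>A. (?F k i)\<^sup>2)) \<le> ?n * (\<Sum>p\<in>?P. (g p)\<^sup>2)"
        using fibre_mean_bound[OF less.prems _ g] 4 by (simp add: of_nat_diff)
      have "(\<Sum>k\<in>A. \<Sum>i\<in>A. 4 * (?n - 1) * ((\<Sum>p | p permutes A \<and> p k = i. (g p)\<^sup>2) - ?c * (?F k i)\<^sup>2))
         \<le> (?n - 2) * transposition_energy A g"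
        unfolding energy_fibres[OF less.prems, symmetric]
        by (intro sum_mono fib)
      moreover have "(\<Sum>k\<in>A. \<Sum>i\<in>A. 4 * (?n - 1) * ((\<Sum>p | p permutes A \<and> p k = i. (g p)\<^sup>2) - ?c * (?F k i)\<^sup>2))
        = 4 * (?n - 1) * (?n * (\<Sum>p\<in>?P. (g p)\<^sup>2) - ?c * (\<Sum>k\<in>A. \<Sum>i\<in>A. (?F k i)\<^sup>2))"
      proof -
        have "(\<Sum>k\<in>A. \<Sum>i\<in>A. \<Sum>p | p permutes A \<and> p k = i. (g p)\<^sup>2) = ?n * (\<Sum>p\<in>?P. (g p)\<^sup>2)"
          by (simp add: sum_permutes_split[OF less.prems, of _ "\<lambda>p. (g p)\<^sup>2", symmetric])
        then show ?thesis by (simp add: sum_subtractf flip: sum_distrib_left)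
      qed
      ultimately have "4 * (?n - 1) * (?n * (\<Sum>p\<in>?P. (g p)\<^sup>2)) - 4 * (?n * (\<Sum>p\<in>?P. (g p)\<^sup>2))
          \<le> (?n - 2) * transposition_energy A g"
        using bnd by (simp add: algebra_simps)
      then have "(?n - 2) * (4 * ?n * (\<Sum>p\<in>?P. (g p)\<^sup>2)) \<le> (?n - 2) * transposition_energy A g"
        by (simp add: algebra_simps)
      then show ?thesis using 4 by (simp add: mult_le_cancel_left_pos)
    qed
  qed
  \<comment> \<open>Subtracting the mean changes neither the energy nor the variance.\<close>
  define mu where "mu = (\<Sum>p\<in>?P. f p) / fact (card A)"
  have s: "(\<Sum>p\<in>?P. f p) = fact (card A) * mu" by (simp add: mu_def)
  have "(\<Sum>p\<in>?P. f p - mu) = 0" by (simp add: sum_subtractf s cP)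
  from mean0[OF this]
  have "4 * ?n * (\<Sum>p\<in>?P. (f p - mu)\<^sup>2) \<le> transposition_energy A f"
    by (simp add: transposition_energy_def)
  moreover have "(\<Sum>p\<in>?P. (f p - mu)\<^sup>2) = (\<Sum>p\<in>?P. (f p)\<^sup>2) - (\<Sum>p\<in>?P. f p)\<^sup>2 / fact (card A)"
  proof -
    have "(\<Sum>p\<in>?P. (f p - mu)\<^sup>2) = (\<Sum>p\<in>?P. (f p)\<^sup>2) - 2 * mu * (\<Sum>p\<in>?P. f p) + fact (card A) * mu\<^sup>2"
      by (simp add: power2_diff sum.distrib sum_subtractf sum_distrib_left cP mult_ac)
    then show ?thesis by (simp add: s power2_eq_square)
  qed
  ultimately show ?case by simp
qed

section \<open>Coordinates for finite families of vectors\<close>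

text \<open>
  The Cholesky decomposition, one point at a time: the row of the new point \<open>z\<close>, divided by
  \<open>sqrt (K z z)\<close>, is a coordinate, and what is left of the kernel, its Schur complement, is again
  positive semidefinite and vanishes at \<open>z\<close>.
\<close>

lemma gram_decomposition:
  fixes K :: "'i \<Rightarrow> 'i \<Rightarrow> real"
  assumes "finite I"
    and "\<And>x y. x \<in> I \<Longrightarrow> y \<in> I \<Longrightarrow> K x y = K y x"
    and "\<And>c. 0 \<le> (\<Sum>x\<in>I. \<Sum>y\<in>I. c x * c y * K x y)"
  shows "\<exists>a :: 'i \<Rightarrow> 'i \<Rightarrow> real. \<forall>x\<in>I. \<forall>y\<in>I. K x y = (\<Sum>k\<in>I. a k x * a k y)"
  using assms
proof (induction I arbitrary: K rule: finite_induct)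
  case empty
  then show ?case by simp
next
  case (insert z I)
  have expand: "0 \<le> (\<Sum>x\<in>I. \<Sum>y\<in>I. c x * c y * K x y) + 2 * t * (\<Sum>x\<in>I. c x * K z x) + t\<^sup>2 * K z z"
    for c :: "'i \<Rightarrow> real" and t
  proof -
    let ?c = "c(z := t)"
    have eq: "?c x = c x" if "x \<in> I" for x using that insert.hyps by auto
    have "(\<Sum>x\<in>insert z I. \<Sum>y\<in>insert z I. ?c x * ?c y * K x y)
      = t * t * K z z + (\<Sum>y\<in>I. t * c y * K z y) + ((\<Sum>x\<in>I. c x * t * K x z) + (\<Sum>x\<in>I. \<Sum>y\<in>I. c x * c y * K x y))"
      using insert.hyps by (simp add: eq sum.distrib del: fun_upd_apply add: fun_upd_same)
    also have "(\<Sum>x\<in>I. c x * t * K x z) = (\<Sum>x\<in>I. t * c x * K z x)"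
      by (intro sum.cong refl) (simp add: insert.prems(1)[of z])
    finally show ?thesis using insert.prems(2)[of ?c]
      by (simp add: power2_eq_square sum_distrib_left algebra_simps)
  qed
  have Kzz: "K z z \<ge> 0" using expand[of "\<lambda>_. 0" 1] by simp
  \<comment> \<open>If \<open>K z z = 0\<close>, the quadratic form is affine in the value at \<open>z\<close>, so its slope vanishes. Division by
    zero then makes the new coordinate zero, as it should be.\<close>
  have null: "K z x = 0" if "K z z = 0" "x \<in> I" for x
  proof (rule ccontr)
    assume nz: "K z x \<noteq> 0"
    let ?c = "\<lambda>y. if y = x then 1 else 0 :: real"
    have "(\<Sum>y\<in>I. ?c y * K z y) = (\<Sum>y\<in>I. if y = x then K z y else 0)"
      by (intro sum.cong) auto
    then have "(\<Sum>y\<in>I. ?c y * K z y) = K z x" using that insert.hyps by simp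
    moreover define q where "q = (\<Sum>x\<in>I. \<Sum>y\<in>I. ?c x * ?c y * K x y)"
    ultimately have "0 \<le> q + 2 * t * K z x" for t
      using expand[of ?c t] that(1) by simp
    from this[of "- (q + 1) / (2 * K z x)"] show False using nz by simp
  qed
  define b where "b x = K z x / sqrt (K z z)" for x
  have bz: "b z * b x = K z x" if "x \<in> insert z I" for x
    using that Kzz null[of x] by (cases "K z z = 0") (auto simp: b_def real_div_sqrt)
  have bb: "b x * b y = K z x * K z y / K z z" for x y
    using Kzz by (simp add: b_def)
  let ?K = "\<lambda>x y. K x y - b x * b y"
  have "\<exists>a. \<forall>x\<in>I. \<forall>y\<in>I. ?K x y = (\<Sum>k\<in>I. a k x * a k y)"
  proof (rule insert.IH)
    show "?K x y = ?K y x" if "x \<in> I" "y \<in> I" for x y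
      using insert.prems(1) that by simp
    show "0 \<le> (\<Sum>x\<in>I. \<Sum>y\<in>I. c x * c y * ?K x y)" for c
    proof -
      define L where "L = (\<Sum>x\<in>I. c x * K z x)"
      have "(\<Sum>x\<in>I. \<Sum>y\<in>I. c x * c y * (b x * b y)) = L * L / K z z"
        unfolding bb L_def sum_product sum_divide_distrib by (intro sum.cong refl) (simp add: field_simps)
      then have "(\<Sum>x\<in>I. \<Sum>y\<in>I. c x * c y * ?K x y) = (\<Sum>x\<in>I. \<Sum>y\<in>I. c x * c y * K x y) - L * L / K z z"
        by (simp add: right_diff_distrib sum_subtractf)
      \<comment> \<open>The value \<open>- L / K z z\<close> at \<open>z\<close> minimises the form.\<close>
      also have "\<dots> = (\<Sum>x\<in>I. \<Sum>y\<in>I. c x * c y * K x y) + 2 * (- L / K z z) * L + (- L / K z z)\<^sup>2 * K z z"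
        by (cases "K z z = 0") (auto simp: field_simps power2_eq_square)
      finally show ?thesis using expand[of c "- L / K z z"] by (simp add: L_def)
    qed
  qed
  then obtain a where a: "\<And>x y. x \<in> I \<Longrightarrow> y \<in> I \<Longrightarrow> ?K x y = (\<Sum>k\<in>I. a k x * a k y)" by blast
  define a' where "a' k x = (if k = z then b x else if x = z then 0 else a k x)" for k x
  have a'I: "(\<Sum>k\<in>I. a' k x * a' k y) = (if x = z \<or> y = z then 0 else (\<Sum>k\<in>I. a k x * a k y))" for x y
    using insert.hyps by (auto simp: a'_def intro!: sum.neutral sum.cong)
  have "K x y = (\<Sum>k\<in>insert z I. a' k x * a' k y)" if xy: "x \<in> insert z I" "y \<in> insert z I" for x y
  proof (cases "x = z \<or> y = z")
    case True
    then show ?thesis using insert.hyps a'I[of x y] bz[OF xy(1)] bz[OF xy(2)] insert.prems(1)[OF xy]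
      by (auto simp: a'_def mult.commute)
  next
    case False
    then show ?thesis using insert.hyps a'I[of x y] a[of x y] xy by (simp add: a'_def)
  qed
  then show ?case by blast
qed

context hilbert_space
begin

lemma carrier_scalars [simp]: "carrier (ring_of_type_algebra :: complex ring) = UNIV"
  by (simp add: ring_of_type_algebra_def)

lemma cinner_zero_left:
  assumes "w \<in> carrier V" shows "cinner V \<zero> w = 0"
  using cinner_add_left[of \<zero> \<zero> w] assms by simp

lemma cinner_self_nonneg:
  assumes "x \<in> carrier V" shows "0 \<le> Re (cinner V x x)"
  using cinner_pos[OF assms] cinner_zero_left[of \<zero>] by (cases "x = \<zero>") auto

lemma cinner_finsum_left:
  assumes "finite I" "u \<in> I \<rightarrow> carrier V" "w \<in> carrier V"
  shows "cinner V (\<Oplus>x\<in>I. u x) w = (\<Sum>x\<in>I. cinner V (u x) w)"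
  using assms
proof (induction I rule: finite_induct)
  case empty
  then show ?case by (simp add: cinner_zero_left)
next
  case (insert x I)
  then show ?case by (simp add: finsum_insert Pi_def cinner_add_left finsum_closed)
qed

lemma cinner_minus_left:
  assumes "x \<in> carrier V" "y \<in> carrier V" "w \<in> carrier V"
  shows "cinner V (x \<ominus> y) w = cinner V x w - cinner V y w"
proof -
  have "cinner V (\<ominus> y) w + cinner V y w = 0"
    using cinner_add_left[of "\<ominus> y" y w] assms by (simp add: l_neg cinner_zero_left)
  then have "cinner V (\<ominus> y) w = - cinner V y w" by (simp add: add_eq_0_iff)
  then show ?thesis using assms by (simp add: a_minus_def cinner_add_left)
qed

lemma hnorm_minus_power2:
  assumes "x \<in> carrier V" "y \<in> carrier V"
  shows "(hnorm V (x \<ominus> y))\<^sup>2 = Re (cinner V x x) + Re (cinner V y y) - 2 * Re (cinner V x y)"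
proof -
  have c: "x \<ominus> y \<in> carrier V" using assms by simp
  have "cinner V x (x \<ominus> y) = cnj (cinner V (x \<ominus> y) x)" "cinner V y (x \<ominus> y) = cnj (cinner V (x \<ominus> y) y)"
    using assms c cinner_commute by blast+
  moreover have "cinner V y x = cnj (cinner V x y)" using assms by (rule cinner_commute)
  ultimately show ?thesis using assms c cinner_self_nonneg[OF c]
    by (simp add: hnorm_def cinner_minus_left)
qed

lemma gram_psd:
  assumes "finite I" "u \<in> I \<rightarrow> carrier V"
  shows "(\<Sum>x\<in>I. \<Sum>y\<in>I. c x * c y * Re (cinner V (u x) (u y)))
       = Re (cinner V (\<Oplus>x\<in>I. complex_of_real (c x) \<odot> u x) (\<Oplus>x\<in>I. complex_of_real (c x) \<odot> u x))"
proof -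
  let ?w = "\<lambda>x. complex_of_real (c x) \<odot> u x"
  let ?s = "\<Oplus>x\<in>I. ?w x"
  have u: "u x \<in> carrier V" if "x \<in> I" for x using assms that by auto
  have w: "?w \<in> I \<rightarrow> carrier V" using u by (auto intro: smult_closed)
  have s: "?s \<in> carrier V" using w by (rule finsum_closed)
  have "cinner V ?s ?s = (\<Sum>x\<in>I. cinner V (?w x) ?s)"
    by (rule cinner_finsum_left[OF assms(1) w s])
  also have "\<dots> = (\<Sum>x\<in>I. of_real (c x) * cnj (cinner V ?s (u x)))"
  proof (intro sum.cong refl)
    fix x assume "x \<in> I"
    then show "cinner V (?w x) ?s = of_real (c x) * cnj (cinner V ?s (u x))"
      using cinner_commute[OF s u, of x] cinner_smult_left[OF u s] by simp
  qed
  also have "\<dots> = (\<Sum>x\<in>I. of_real (c x) * cnj (\<Sum>y\<in>I. of_real (c y) * cinner V (u y) (u x)))"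
    by (intro sum.cong refl) (simp add: cinner_finsum_left[OF assms(1) w] cinner_smult_left u)
  also have "\<dots> = (\<Sum>x\<in>I. of_real (c x) * (\<Sum>y\<in>I. of_real (c y) * cinner V (u x) (u y)))"
  proof (rule sum.cong, rule refl)
    fix x assume x: "x \<in> I"
    have "cnj (\<Sum>y\<in>I. of_real (c y) * cinner V (u y) (u x)) = (\<Sum>y\<in>I. of_real (c y) * cnj (cinner V (u y) (u x)))"
      by simp
    also have "\<dots> = (\<Sum>y\<in>I. of_real (c y) * cinner V (u x) (u y))"
      by (intro sum.cong refl) (simp only: cinner_commute[OF u u[OF x], symmetric])
    finally show "of_real (c x) * cnj (\<Sum>y\<in>I. of_real (c y) * cinner V (u y) (u x))
        = of_real (c x) * (\<Sum>y\<in>I. of_real (c y) * cinner V (u x) (u y))" by (simp only:)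
  qed
  finally show ?thesis by (simp add: sum_distrib_left mult.assoc)
qed

lemma gram_coordinates:
  assumes "finite I" "u \<in> I \<rightarrow> carrier V"
  obtains a :: "'i \<Rightarrow> 'i \<Rightarrow> real" where
    "\<And>x y. x \<in> I \<Longrightarrow> y \<in> I \<Longrightarrow> Re (cinner V (u x) (u y)) = (\<Sum>k\<in>I. a k x * a k y)"
proof -
  have u: "u x \<in> carrier V" if "x \<in> I" for x using assms that by auto
  have "\<exists>a :: 'i \<Rightarrow> 'i \<Rightarrow> real. \<forall>x\<in>I. \<forall>y\<in>I. Re (cinner V (u x) (u y)) = (\<Sum>k\<in>I. a k x * a k y)"
  proof (rule gram_decomposition[OF assms(1)])
    show "Re (cinner V (u x) (u y)) = Re (cinner V (u y) (u x))" if "x \<in> I" "y \<in> I" for x y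
      using cinner_commute[OF u[OF that(1)] u[OF that(2)]] by simp
    show "0 \<le> (\<Sum>x\<in>I. \<Sum>y\<in>I. c x * c y * Re (cinner V (u x) (u y)))" for c
      unfolding gram_psd[OF assms]
      by (intro cinner_self_nonneg finsum_closed) (auto intro!: smult_closed u)
  qed
  then show ?thesis using that by blast
qed

lemma cinner_smult_self:
  assumes "x \<in> carrier V" shows "cinner V (a \<odot> x) (a \<odot> x) = a * cnj a * cinner V x x"
proof -
  have ax: "a \<odot> x \<in> carrier V" using assms by (simp add: smult_closed)
  have "cinner V x (a \<odot> x) = cnj (a * cinner V x x)"
    using cinner_commute[OF ax assms] cinner_smult_left[OF assms assms] by simp
  moreover have "cinner V x x = cnj (cinner V x x)" using assms cinner_commute by blast
  ultimately show ?thesis using cinner_smult_left[OF assms ax, of a] by simp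
qed

lemma exists_unit_vector:
  assumes "carrier V \<noteq> {\<zero>}"
  shows "\<exists>v\<in>carrier V. hnorm V v = 1"
proof -
  obtain x where x: "x \<in> carrier V" "x \<noteq> \<zero>" using assms by auto
  define r where "r = Re (cinner V x x)"
  have r: "r > 0" using cinner_pos x by (simp add: r_def)
  have "Re (cinner V (complex_of_real (1 / sqrt r) \<odot> x) (complex_of_real (1 / sqrt r) \<odot> x))
      = (1 / sqrt r) * (1 / sqrt r) * r"
    by (simp add: cinner_smult_self x(1) r_def)
  then have "hnorm V (complex_of_real (1 / sqrt r) \<odot> x) = 1"
    using r by (simp add: hnorm_def)
  then show ?thesis using x by (intro bexI[of _ "complex_of_real (1 / sqrt r) \<odot> x"]) (auto intro: smult_closed)
qed

end

context unitary_rep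
begin

lemma rep_closed:
  assumes "g \<in> carrier G" "x \<in> carrier V" shows "R g x \<in> carrier V"
  using element_image[OF assms] by simp

lemma rep_finsum:
  assumes "g \<in> carrier G" "finite I" "u \<in> I \<rightarrow> carrier V"
  shows "R g (\<Oplus>\<^bsub>V\<^esub>x\<in>I. u x) = (\<Oplus>\<^bsub>V\<^esub>x\<in>I. R g (u x))"
  using assms(2,3)
proof (induction I rule: finite_induct)
  case empty
  have "R g \<zero>\<^bsub>V\<^esub> \<oplus>\<^bsub>V\<^esub> R g \<zero>\<^bsub>V\<^esub> = R g \<zero>\<^bsub>V\<^esub>"
    using rep_add[OF assms(1), of "\<zero>\<^bsub>V\<^esub>" "\<zero>\<^bsub>V\<^esub>"] by simp
  then show ?case using rep_closed[OF assms(1), of "\<zero>\<^bsub>V\<^esub>"] by simp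
next
  case (insert x I)
  then show ?case using assms(1)
    by (simp add: finsum_insert Pi_def rep_add rep_closed finsum_closed)
qed

lemma orbit_finsum_invariant:
  assumes G: "finite (carrier G)" and v: "v \<in> carrier V" and g: "g \<in> carrier G"
  shows "R g (\<Oplus>\<^bsub>V\<^esub>h\<in>carrier G. R h v) = (\<Oplus>\<^bsub>V\<^esub>h\<in>carrier G. R h v)"
proof -
  interpret G: group G by (rule group_hom.axioms(1)[OF group_hom])
  have inj: "inj_on (\<lambda>h. g \<otimes>\<^bsub>G\<^esub> h) (carrier G)"
    using g by (auto simp: inj_on_def)
  have im: "(\<lambda>h. g \<otimes>\<^bsub>G\<^esub> h) ` carrier G = carrier G"
    using g G.surj_const_mult by blast
  have "R g (\<Oplus>\<^bsub>V\<^esub>h\<in>carrier G. R h v) = (\<Oplus>\<^bsub>V\<^esub>h\<in>carrier G. R g (R h v))"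
    by (rule rep_finsum) (use G g v rep_closed in auto)
  also have "\<dots> = (\<Oplus>\<^bsub>V\<^esub>h\<in>carrier G. R (g \<otimes>\<^bsub>G\<^esub> h) v)"
    by (rule finsum_cong') (use g v rep_closed composition_rule in auto)
  also have "\<dots> = (\<Oplus>\<^bsub>V\<^esub>h\<in>(\<lambda>h. g \<otimes>\<^bsub>G\<^esub> h) ` carrier G. R h v)"
    by (rule finsum_reindex[symmetric]) (use inj im v rep_closed in auto)
  finally show ?thesis unfolding im .
qed

end

section \<open>Representations without invariant vectors\<close>

text \<open>
  The spectral gap of \<open>poincare_permutations\<close>, carried to a Hilbert space: it is applied to each real
  coordinate of \<open>p \<mapsto> R p v\<close>. The coordinates have mean zero because the sum of the orbit is
  invariant, hence zero; and since the operators are isometries, each permutation contributes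
  the same amount to both sides.
\<close>

lemma transposition_displacement:
  fixes V :: "'v hilbert"
  assumes rep: "(V, R) \<in> reps_without_invariants (sym_group n)"
    and v: "v \<in> carrier V" "hnorm V v = 1"
  shows "4 * real n \<le> (\<Sum>a\<in>{1..n}. \<Sum>b\<in>{1..n}. (hnorm V (R (Transposition.transpose a b) v \<ominus>\<^bsub>V\<^esub> v))\<^sup>2)"
proof -
  interpret unitary_rep "sym_group n" V R using rep by (simp add: reps_without_invariants_def)
  let ?P = "{p. p permutes {1..n}}"
  have P: "carrier (sym_group n) = ?P" by (simp add: sym_group_def)
  have fin: "finite ?P" by (simp add: finite_permutations)
  have cl: "(\<lambda>p. R p v) \<in> ?P \<rightarrow> carrier V" using rep_closed v by (auto simp: P)
  have unit: "Re (cinner V v v) = 1" using v(2) by (simp add: hnorm_def)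
  have tr: "Transposition.transpose a b \<in> ?P" if "a \<in> {1..n}" "b \<in> {1..n}" for a b
    using that by (simp add: permutes_swap_id)
  have idP: "id \<in> ?P" by (simp add: permutes_id)
  have Rid: "R id v = v" using id_eq_one v by (metis restrict_apply' sym_group_one)
  have comp: "R p (R q v) = R (p \<circ> q) v" if "p \<in> ?P" "q \<in> ?P" for p q
    using composition_rule[OF v(1), of p q] that by (simp add: P sym_group_mult)
  obtain a where a: "\<And>p q. p \<in> ?P \<Longrightarrow> q \<in> ?P \<Longrightarrow> Re (cinner V (R p v) (R q v)) = (\<Sum>k\<in>?P. a k p * a k q)"
    using gram_coordinates[OF fin cl] by blast
  have orbit0: "(\<Oplus>\<^bsub>V\<^esub>p\<in>?P. R p v) = \<zero>\<^bsub>V\<^esub>"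
    using rep orbit_finsum_invariant[OF _ v(1)] fin finsum_closed[OF cl]
    by (auto simp: reps_without_invariants_def P)
  have mean0: "(\<Sum>p\<in>?P. a k p) = 0" if k: "k \<in> ?P" for k
  proof -
    have "(\<Oplus>\<^bsub>V\<^esub>p\<in>?P. complex_of_real 1 \<odot>\<^bsub>V\<^esub> R p v) = (\<Oplus>\<^bsub>V\<^esub>p\<in>?P. R p v)"
      using cl smult_one by (intro finsum_cong') (auto simp: ring_of_type_algebra_def)
    then have "(\<Sum>p\<in>?P. \<Sum>q\<in>?P. 1 * 1 * Re (cinner V (R p v) (R q v))) = 0"
      unfolding gram_psd[OF fin cl, of "\<lambda>_. 1"] by (simp only: orbit0) (simp add: cinner_zero_left)
    then have "(\<Sum>p\<in>?P. \<Sum>q\<in>?P. \<Sum>k\<in>?P. a k p * a k q) = 0" by (simp add: a)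
    moreover have "(\<Sum>p\<in>?P. \<Sum>q\<in>?P. \<Sum>k\<in>?P. a k p * a k q) = (\<Sum>k\<in>?P. (\<Sum>p\<in>?P. a k p)\<^sup>2)"
    proof -
      have "(\<Sum>p\<in>?P. \<Sum>q\<in>?P. \<Sum>k\<in>?P. a k p * a k q) = (\<Sum>p\<in>?P. \<Sum>k\<in>?P. \<Sum>q\<in>?P. a k p * a k q)"
        by (rule sum.cong, rule refl, rule sum.swap)
      also have "\<dots> = (\<Sum>k\<in>?P. \<Sum>p\<in>?P. \<Sum>q\<in>?P. a k p * a k q)" by (rule sum.swap)
      finally show ?thesis by (simp only: power2_eq_square sum_product)
    qed
    ultimately show ?thesis using k fin by (simp add: sum_nonneg_eq_0_iff)
  qed
  have norm: "(\<Sum>k\<in>?P. (a k p)\<^sup>2) = 1" if "p \<in> ?P" for p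
    using a[OF that that] rep_cinner[of p v v] v that unit by (simp add: P power2_eq_square)
  have disp: "(\<Sum>k\<in>?P. (a k (p \<circ> Transposition.transpose i j) - a k p)\<^sup>2)
      = (hnorm V (R (Transposition.transpose i j) v \<ominus>\<^bsub>V\<^esub> v))\<^sup>2"
    if p: "p \<in> ?P" and ij: "i \<in> {1..n}" "j \<in> {1..n}" for p i j
  proof -
    let ?t = "Transposition.transpose i j"
    have t: "?t \<in> ?P" using tr ij by blast
    have pt: "p \<circ> ?t \<in> ?P" using p t by (simp add: permutes_compose)
    have Rt: "R ?t v \<in> carrier V" using rep_closed v t by (simp add: P)
    have "cinner V (R (p \<circ> ?t) v) (R p v) = cinner V (R p (R ?t v)) (R p v)"
      by (simp only: comp[OF p t])
    also have "\<dots> = cinner V (R ?t v) v" using rep_cinner[of p "R ?t v" v] p Rt v by (simp add: P)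
    finally have "(\<Sum>k\<in>?P. a k (p \<circ> ?t) * a k p) = Re (cinner V (R ?t v) v)"
      using a[OF pt p] by simp
    moreover have "(\<Sum>k\<in>?P. (a k (p \<circ> ?t) - a k p)\<^sup>2)
        = (\<Sum>k\<in>?P. (a k (p \<circ> ?t))\<^sup>2) + (\<Sum>k\<in>?P. (a k p)\<^sup>2) - 2 * (\<Sum>k\<in>?P. a k (p \<circ> ?t) * a k p)"
      by (simp add: power2_diff sum.distrib sum_subtractf sum_distrib_left mult.assoc)
    ultimately have "(\<Sum>k\<in>?P. (a k (p \<circ> ?t) - a k p)\<^sup>2) = 2 - 2 * Re (cinner V (R ?t v) v)"
      using norm p pt by simp
    also have "\<dots> = (hnorm V (R ?t v \<ominus>\<^bsub>V\<^esub> v))\<^sup>2"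
      using hnorm_minus_power2[OF Rt v(1)] rep_cinner[of ?t v v] t v unit by (simp add: P)
    finally show ?thesis .
  qed
  have cardP: "card ?P = fact n" by (simp add: card_permutations)
  have "4 * real n * fact n = (\<Sum>k\<in>?P. 4 * real n * (\<Sum>p\<in>?P. (a k p)\<^sup>2))"
    using sum.swap[of "\<lambda>k p. (a k p)\<^sup>2" ?P ?P] norm cardP by (simp flip: sum_distrib_left)
  also have "\<dots> \<le> (\<Sum>k\<in>?P. transposition_energy {1..n} (a k))"
  proof (rule sum_mono)
    fix k assume "k \<in> ?P"
    then show "4 * real n * (\<Sum>p\<in>?P. (a k p)\<^sup>2) \<le> transposition_energy {1..n} (a k)"
      using poincare_permutations[of "{1..n}" "a k"] mean0 by simp
  qed
  also have "\<dots> = (\<Sum>i\<in>{1..n}. \<Sum>j\<in>{1..n}. \<Sum>k\<in>?P. \<Sum>p\<in>?P. (a k (p \<circ> Transposition.transpose i j) - a k p)\<^sup>2)"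
    unfolding transposition_energy_def by (simp only: sum.swap[of _ "{1..n}" ?P])
  also have "\<dots> = (\<Sum>i\<in>{1..n}. \<Sum>j\<in>{1..n}. \<Sum>p\<in>?P. \<Sum>k\<in>?P. (a k (p \<circ> Transposition.transpose i j) - a k p)\<^sup>2)"
    by (rule sum.cong, rule refl, rule sum.cong, rule refl, rule sum.swap)
  also have "\<dots> = (\<Sum>i\<in>{1..n}. \<Sum>j\<in>{1..n}. fact n * (hnorm V (R (Transposition.transpose i j) v \<ominus>\<^bsub>V\<^esub> v))\<^sup>2)"
    by (intro sum.cong refl) (simp add: disp cardP del: One_nat_def)
  also have "\<dots> = fact n * (\<Sum>i\<in>{1..n}. \<Sum>j\<in>{1..n}. (hnorm V (R (Transposition.transpose i j) v \<ominus>\<^bsub>V\<^esub> v))\<^sup>2)"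
    by (simp add: sum_distrib_left)
  finally show ?thesis by (simp add: mult.commute[of _ "fact n"])
qed

lemma
  fixes d :: "(nat \<Rightarrow> nat) \<Rightarrow> real"
  assumes n: "2 \<le> n" and d: "\<And>q. 0 \<le> d q"
  shows Max_displacement_nonneg: "0 \<le> (MAX q\<in>transpositions n. d q)"
    and displacement_le_Max: "a \<in> {1..n} \<Longrightarrow> b \<in> {1..n} \<Longrightarrow> a \<noteq> b \<Longrightarrow> d (Transposition.transpose a b) \<le> (MAX q\<in>transpositions n. d q)"
proof -
  have "transpositions n \<subseteq> (\<lambda>(i, j). Transposition.transpose i j) ` ({1..n} \<times> {1..n})"
    by (auto simp: transpositions_def)
  then have fin: "finite (d ` transpositions n)" by (meson finite_SigmaI finite_atLeastAtMost finite_imageI finite_subset)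
  show le: "a \<in> {1..n} \<Longrightarrow> b \<in> {1..n} \<Longrightarrow> a \<noteq> b \<Longrightarrow> d (Transposition.transpose a b) \<le> (MAX q\<in>transpositions n. d q)" for a b
    by (rule Max_ge[OF fin]) (auto simp: transpositions_def)
  show "0 \<le> (MAX q\<in>transpositions n. d q)"
    using le[of 1 2] d[of "Transposition.transpose 1 2"] n by simp
qed

text \<open>
  The maximum dominates the mean of the \<open>n (n - 1)\<close> squares in \<open>transposition_displacement\<close>.
\<close>

lemma reps_displacement_Max:
  fixes V :: "'v hilbert"
  assumes n: "2 \<le> n" and rep: "(V, R) \<in> reps_without_invariants (sym_group n)"
    and v: "v \<in> carrier V" "hnorm V v = 1"
  shows "2 / sqrt (real n - 1) \<le> (MAX q\<in>transpositions n. hnorm V (R q v \<ominus>\<^bsub>V\<^esub> v))"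
proof -
  interpret unitary_rep "sym_group n" V R using rep by (simp add: reps_without_invariants_def)
  let ?d = "\<lambda>q. hnorm V (R q v \<ominus>\<^bsub>V\<^esub> v)"
  \<comment> \<open>The sign of \<open>hnorm\<close> is known on the carrier only, hence the truncation.\<close>
  define d where "d q = (if q \<in> carrier (sym_group n) then ?d q else 0)" for q
  have d0: "0 \<le> d q" for q
    using cinner_self_nonneg rep_closed v by (auto simp: d_def hnorm_def)
  have tr: "Transposition.transpose a b \<in> carrier (sym_group n)" if "a \<in> {1..n}" "b \<in> {1..n}" for a b
    using that by (simp add: sym_group_def permutes_swap_id)
  have eq: "(\<lambda>q. d q) ` transpositions n = ?d ` transpositions n"
    by (intro image_cong refl) (use tr in \<open>auto simp: d_def transpositions_def\<close>)
  define M where "M = (MAX q\<in>transpositions n. d q)"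
  have M0: "0 \<le> M" unfolding M_def by (rule Max_displacement_nonneg[where d = d, OF n d0])
  have Rid: "R id v = v" using id_eq_one v by (metis restrict_apply' sym_group_one)
  have le: "(?d (Transposition.transpose a b))\<^sup>2 \<le> (if a = b then 0 else M\<^sup>2)" if ab: "a \<in> {1..n}" "b \<in> {1..n}" for a b
  proof (cases "a = b")
    case True
    then show ?thesis using hnorm_minus_power2[OF v(1) v(1)] Rid by simp
  next
    case False
    then have "d (Transposition.transpose a b) \<le> M"
      unfolding M_def using displacement_le_Max[where d = d, OF n d0] ab by blast
    then show ?thesis using False d0[of "Transposition.transpose a b"] tr[OF ab]
      by (simp add: d_def power_mono)
  qed
  have "4 * real n \<le> (\<Sum>a\<in>{1..n}. \<Sum>b\<in>{1..n}. (?d (Transposition.transpose a b))\<^sup>2)"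
    by (rule transposition_displacement[OF rep v])
  also have "\<dots> \<le> (\<Sum>a\<in>{1..n}. \<Sum>b\<in>{1..n}. if a = b then 0 else M\<^sup>2)"
    by (intro sum_mono le)
  also have "\<dots> = (\<Sum>a\<in>{1..n}. \<Sum>b\<in>{1..n}. M\<^sup>2 - (if a = b then M\<^sup>2 else 0))"
    by (intro sum.cong refl) simp
  also have "\<dots> = (\<Sum>a\<in>{1..n}. real n * M\<^sup>2 - M\<^sup>2)"
    by (intro sum.cong refl) (simp add: sum_subtractf)
  also have "\<dots> = real n * ((real n - 1) * M\<^sup>2)" by (simp add: algebra_simps)
  finally have "real n * 4 \<le> real n * ((real n - 1) * M\<^sup>2)" by simp
  then have "4 \<le> (real n - 1) * M\<^sup>2" using n by (simp only: mult_le_cancel_left_pos of_nat_0_less_iff)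
  then have "4 / (real n - 1) \<le> M\<^sup>2" using n by (simp add: field_simps)
  then have "(2 / sqrt (real n - 1))\<^sup>2 \<le> M\<^sup>2" using n by (simp add: power_divide)
  then have "2 / sqrt (real n - 1) \<le> M" using M0 by (rule power2_le_imp_le)
  then show ?thesis by (simp only: M_def eq)
qed

lemma kazhdan_rep_lower:
  fixes V :: "'v hilbert"
  assumes n: "2 \<le> n" and rep: "(V, R) \<in> reps_without_invariants (sym_group n)"
  shows "2 / sqrt (real n - 1) \<le> kazhdan_rep (transpositions n) V R"
proof -
  interpret unitary_rep "sym_group n" V R using rep by (simp add: reps_without_invariants_def)
  have "\<exists>v\<in>carrier V. hnorm V v = 1"
    using rep by (intro exists_unit_vector) (simp add: reps_without_invariants_def)
  then show ?thesis unfolding kazhdan_rep_def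
    by (intro cINF_greatest) (use reps_displacement_Max[OF n rep] in auto)
qed

section \<open>Distances in a planar configuration\<close>

text \<open>
  With \<open>s i = \<bar>z i\<bar>\<^sup>2\<close> and the real Gram matrix \<open>g\<close>, whose rows sum to zero, the squared distances are
  \<open>s i + s j - 2 * g i j\<close>. All mixed terms of the square vanish, which leaves
  \<open>2 n \<Sum> s\<^sup>2 + 2 (\<Sum> s)\<^sup>2 + 4 \<Sum> g\<^sup>2\<close>. The first term is at least \<open>2\<close> by the inequality between the means;
  the last one also, because \<open>g\<close> has trace \<open>1\<close> and rank at most \<open>2\<close>: this is where the
  dimension of the plane enters.
\<close>

lemma sum_fourth_distances_ge:
  fixes z :: "'i \<Rightarrow> complex"
  assumes I: "finite I" "I \<noteq> {}" and z: "(\<Sum>i\<in>I. z i) = 0" and unit: "(\<Sum>i\<in>I. (cmod (z i))\<^sup>2) = 1"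
  shows "6 \<le> (\<Sum>i\<in>I. \<Sum>j\<in>I. ((cmod (z i - z j))\<^sup>2)\<^sup>2)"
    and "(\<Sum>i\<in>I. \<Sum>j\<in>I. (cmod (z i - z j))\<^sup>2) = 2 * real (card I)"
proof -
  define a b s where "a i = Re (z i)" and "b i = Im (z i)" and "s i = (cmod (z i))\<^sup>2" for i
  define g where "g i j = a i * a j + b i * b j" for i j
  have D: "(cmod (z i - z j))\<^sup>2 = s i + s j - 2 * g i j" for i j
    unfolding a_def b_def s_def g_def cmod_power2 by (simp add: power2_eq_square algebra_simps)
  have sa: "(\<Sum>i\<in>I. a i) = 0" and sb: "(\<Sum>i\<in>I. b i) = 0"
    using z by (simp_all add: a_def b_def flip: Re_sum Im_sum)
  have ss: "(\<Sum>i\<in>I. s i) = 1" using unit by (simp add: s_def)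
  have gr: "(\<Sum>j\<in>I. g i j) = 0" for i
    by (simp add: g_def sum.distrib sa sb flip: sum_distrib_left)
  have gc: "(\<Sum>i\<in>I. g i j) = 0" for j
    using gr[of j] by (simp add: g_def mult.commute)
  show "(\<Sum>i\<in>I. \<Sum>j\<in>I. (cmod (z i - z j))\<^sup>2) = 2 * real (card I)"
    by (simp add: D sum.distrib sum_subtractf ss gr flip: sum_distrib_left)
  define n where "n = real (card I)"
  have n: "n > 0" using I by (simp add: n_def card_gt_0_iff)
  have sq: "(s i + s j - 2 * g i j)\<^sup>2
     = (s i)\<^sup>2 + (s j)\<^sup>2 + 2 * (s i * s j) + 4 * (g i j)\<^sup>2 - 4 * (s i * g i j) - 4 * (s j * g i j)" for i j
    by (simp add: power2_eq_square algebra_simps)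
  have c1: "(\<Sum>i\<in>I. \<Sum>j\<in>I. s i * s j) = 1" using ss by (simp flip: sum_product)
  have c2: "(\<Sum>i\<in>I. \<Sum>j\<in>I. s i * g i j) = 0" by (simp add: gr flip: sum_distrib_left)
  have c3: "(\<Sum>i\<in>I. \<Sum>j\<in>I. s j * g i j) = 0"
    by (subst sum.swap) (simp add: gc flip: sum_distrib_left)
  have exp: "(\<Sum>i\<in>I. \<Sum>j\<in>I. ((cmod (z i - z j))\<^sup>2)\<^sup>2)
     = 2 * n * (\<Sum>i\<in>I. (s i)\<^sup>2) + 2 + 4 * (\<Sum>i\<in>I. \<Sum>j\<in>I. (g i j)\<^sup>2)"
    by (simp add: D sq sum.distrib sum_subtractf ss gr c3 n_def flip: sum_distrib_left)
  have s2: "1 \<le> n * (\<Sum>i\<in>I. (s i)\<^sup>2)"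
  proof -
    define c where "c = 1 / n"
    have "0 \<le> (\<Sum>i\<in>I. (s i - c)\<^sup>2)" by (intro sum_nonneg) auto
    also have "\<dots> = (\<Sum>i\<in>I. (s i)\<^sup>2) - 2 * c * (\<Sum>i\<in>I. s i) + n * c\<^sup>2"
      by (simp add: power2_diff sum.distrib sum_subtractf sum_distrib_left sum_distrib_right n_def mult_ac)
    also have "\<dots> = (\<Sum>i\<in>I. (s i)\<^sup>2) - 1 / n" using n by (simp add: ss c_def power2_eq_square)
    finally show ?thesis using n by (simp add: field_simps)
  qed
  have g2: "1 \<le> 2 * (\<Sum>i\<in>I. \<Sum>j\<in>I. (g i j)\<^sup>2)"
  proof -
    define p q r where "p = (\<Sum>i\<in>I. a i * a i)" and "q = (\<Sum>i\<in>I. b i * b i)" and "r = (\<Sum>i\<in>I. a i * b i)"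
    have "(g i j)\<^sup>2 = (a i * a i) * (a j * a j) + (b i * b i) * (b j * b j) + 2 * ((a i * b i) * (a j * b j))" for i j
      by (simp add: g_def power2_eq_square algebra_simps)
    then have G: "(\<Sum>i\<in>I. \<Sum>j\<in>I. (g i j)\<^sup>2) = p * p + q * q + 2 * (r * r)"
      unfolding p_def q_def r_def sum_product by (simp add: sum.distrib sum_distrib_left)
    have "p + q = 1"
      using ss unfolding p_def q_def s_def a_def b_def cmod_power2 by (simp add: power2_eq_square sum.distrib)
    moreover have "(p + q)\<^sup>2 \<le> 2 * (p * p + q * q)"
      using zero_le_power2[of "p - q"] by (simp add: power2_eq_square algebra_simps)
    ultimately have "1 \<le> 2 * (p * p + q * q)" by simp
    also have "\<dots> \<le> 2 * (p * p + q * q + 2 * (r * r))" by (intro mult_left_mono) auto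
    finally show ?thesis unfolding G .
  qed
  show "6 \<le> (\<Sum>i\<in>I. \<Sum>j\<in>I. ((cmod (z i - z j))\<^sup>2)\<^sup>2)"
    unfolding exp using s2 g2 by linarith
qed

text \<open>
  If \<open>M\<close> bounds the squared distances \<open>D\<close>, then \<open>6 \<le> \<Sum> D\<^sup>2 \<le> M \<Sum> D = 2 n M\<close>. For the vertices of an
  equilateral triangle there is equality.
\<close>

lemma planar_max_distance:
  fixes z :: "'i \<Rightarrow> complex"
  assumes I: "finite I" "I \<noteq> {}" and z: "(\<Sum>i\<in>I. z i) = 0" and unit: "(\<Sum>i\<in>I. (cmod (z i))\<^sup>2) = 1"
    and M: "\<And>i j. i \<in> I \<Longrightarrow> j \<in> I \<Longrightarrow> (cmod (z i - z j))\<^sup>2 \<le> M"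
  shows "3 / real (card I) \<le> M"
proof -
  have "6 \<le> (\<Sum>i\<in>I. \<Sum>j\<in>I. ((cmod (z i - z j))\<^sup>2)\<^sup>2)" by (rule sum_fourth_distances_ge[OF I z unit])
  also have "\<dots> \<le> (\<Sum>i\<in>I. \<Sum>j\<in>I. M * (cmod (z i - z j))\<^sup>2)"
    using M by (intro sum_mono) (simp add: power2_eq_square mult_right_mono)
  also have "\<dots> = M * (2 * real (card I))"
    using sum_fourth_distances_ge(2)[OF I z unit] by (simp flip: sum_distrib_left)
  finally show ?thesis using I by (simp add: field_simps card_gt_0_iff)
qed

section \<open>Hilbert spaces of functions on a finite set\<close>

text \<open>
  A pointwise closed space \<open>S\<close> of functions on a finite set, with the pointwise operations and
  the standard inner product, carried over to the elements of an arbitrary type by the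
  bijection \<open>coord\<close>. This covers both spaces needed here: the standard representation, where
  \<open>coord\<close> is the identity, and the copy in \<open>'v\<close> of a space of matrices.
\<close>

locale function_model =
  fixes I :: "'i set" and S :: "('i \<Rightarrow> complex) set" and W :: "'v hilbert" (structure)
    and coord :: "'v \<Rightarrow> 'i \<Rightarrow> complex"
  assumes finite_index: "finite I"
    and support: "\<lbrakk>f \<in> S; k \<notin> I\<rbrakk> \<Longrightarrow> f k = 0"
    and closed_pointwise: "\<lbrakk>\<And>m. s m \<in> S; \<And>k. (\<lambda>m. s m k) \<longlonglongrightarrow> l k\<rbrakk> \<Longrightarrow> l \<in> S"
    and bij_coord: "bij_betw coord (carrier W) S"
    and zero_in: "\<zero> \<in> carrier W" and coord_zero: "coord \<zero> k = 0"
    and add_in: "\<lbrakk>x \<in> carrier W; y \<in> carrier W\<rbrakk> \<Longrightarrow> x \<oplus> y \<in> carrier W"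
    and coord_add: "\<lbrakk>x \<in> carrier W; y \<in> carrier W\<rbrakk> \<Longrightarrow> coord (x \<oplus> y) k = coord x k + coord y k"
    and smult_in: "x \<in> carrier W \<Longrightarrow> c \<odot> x \<in> carrier W"
    and coord_smult: "x \<in> carrier W \<Longrightarrow> coord (c \<odot> x) k = c * coord x k"
    and cinner_coord: "\<lbrakk>x \<in> carrier W; y \<in> carrier W\<rbrakk> \<Longrightarrow> cinner W x y = (\<Sum>k\<in>I. coord x k * cnj (coord y k))"
begin

lemma coord_in: "x \<in> carrier W \<Longrightarrow> coord x \<in> S"
  using bij_coord by (auto simp: bij_betw_def)

lemma coord_eqI: "\<lbrakk>x \<in> carrier W; y \<in> carrier W; \<And>k. coord x k = coord y k\<rbrakk> \<Longrightarrow> x = y"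
  using bij_coord by (metis bij_betw_def ext inj_onD)

lemma module_over_complex: "Module.module (ring_of_type_algebra :: complex ring) W"
proof (rule moduleI)
  show "abelian_group W"
  proof (rule abelian_groupI)
    show "\<exists>y\<in>carrier W. y \<oplus> x = \<zero>" if "x \<in> carrier W" for x
      using that by (intro bexI[of _ "(-1) \<odot> x"] coord_eqI)
        (simp_all add: zero_in add_in smult_in coord_add coord_smult coord_zero)
  qed (auto intro!: coord_eqI simp: zero_in add_in coord_add coord_zero)
  show "cring (ring_of_type_algebra :: complex ring)" by (rule cring_from_type_algebra)
qed (auto intro!: coord_eqI simp: ring_of_type_algebra_def add_in smult_in coord_add coord_smult algebra_simps)

sublocale mod: Module.module "ring_of_type_algebra :: complex ring" W
  by (rule module_over_complex)

lemma coord_minus: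
  assumes "x \<in> carrier W" "y \<in> carrier W"
  shows "coord (x \<ominus> y) k = coord x k - coord y k"
proof -
  have "coord (\<ominus> y \<oplus> y) k = 0" using assms by (simp add: mod.l_neg coord_zero)
  then have "coord (\<ominus> y) k = - coord y k" using assms by (simp add: coord_add add_eq_0_iff2)
  then show ?thesis using assms by (simp add: a_minus_def coord_add)
qed

lemma cinner_self:
  assumes "x \<in> carrier W" shows "cinner W x x = of_real (\<Sum>k\<in>I. (cmod (coord x k))\<^sup>2)"
  using assms by (simp add: cinner_coord flip: complex_norm_square)

lemma hnorm_coord:
  assumes "x \<in> carrier W" shows "hnorm W x = sqrt (\<Sum>k\<in>I. (cmod (coord x k))\<^sup>2)"
  using assms by (simp add: hnorm_def cinner_self)

lemma coord_le_hnorm: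
  assumes "x \<in> carrier W" shows "cmod (coord x k) \<le> hnorm W x"
proof (cases "k \<in> I")
  case True
  then have "(cmod (coord x k))\<^sup>2 \<le> (\<Sum>k\<in>I. (cmod (coord x k))\<^sup>2)"
    using finite_index by (intro member_le_sum) auto
  then show ?thesis unfolding hnorm_coord[OF assms] by (simp add: real_le_rsqrt)
next
  case False
  then show ?thesis using support[OF coord_in[OF assms]] by (simp add: hnorm_coord[OF assms] sum_nonneg)
qed

lemma hilbert_space: "hilbert_space W"
proof (intro hilbert_space.intro module_over_complex hilbert_space_axioms.intro)
  fix s :: "nat \<Rightarrow> 'v"
  assume s: "\<And>k. s k \<in> carrier W"
    and cauchy: "\<And>e. e > 0 \<Longrightarrow> \<exists>N. \<forall>j\<ge>N. \<forall>k\<ge>N. hnorm W (s j \<ominus> s k) < e"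
  have sm: "s j \<ominus> s m \<in> carrier W" for j m using s by simp
  have "convergent (\<lambda>m. coord (s m) k)" for k
  proof (rule Cauchy_convergent, rule metric_CauchyI)
    fix e :: real assume "e > 0"
    then obtain N where N: "\<And>j m. j \<ge> N \<Longrightarrow> m \<ge> N \<Longrightarrow> hnorm W (s j \<ominus> s m) < e" using cauchy by blast
    have "dist (coord (s j) k) (coord (s m) k) < e" if "j \<ge> N" "m \<ge> N" for j m
      using coord_le_hnorm[OF sm, of j m k] N[OF that] by (simp add: coord_minus s dist_norm)
    then show "\<exists>N. \<forall>j\<ge>N. \<forall>m\<ge>N. dist (coord (s j) k) (coord (s m) k) < e" by blast
  qed
  moreover define l where "l k = lim (\<lambda>m. coord (s m) k)" for k
  ultimately have l: "(\<lambda>m. coord (s m) k) \<longlonglongrightarrow> l k" for k by (simp add: convergent_LIMSEQ_iff)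
  have "l \<in> S" by (rule closed_pointwise[OF coord_in[OF s] l])
  then obtain w where w: "w \<in> carrier W" "coord w = l" using bij_coord by (auto simp: bij_betw_def)
  have sw: "s m \<ominus> w \<in> carrier W" for m using s w by simp
  have "(\<lambda>m. hnorm W (s m \<ominus> w)) = (\<lambda>m. sqrt (\<Sum>k\<in>I. (cmod (coord (s m) k - l k))\<^sup>2))"
    by (simp add: hnorm_coord[OF sw] coord_minus s w)
  moreover have "(\<lambda>m. sqrt (\<Sum>k\<in>I. (cmod (coord (s m) k - l k))\<^sup>2)) \<longlonglongrightarrow> sqrt (\<Sum>k\<in>I. (cmod (l k - l k))\<^sup>2)"
    by (intro tendsto_intros l)
  ultimately have "(\<lambda>m. hnorm W (s m \<ominus> w)) \<longlonglongrightarrow> 0" by simp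
  then show "\<exists>l\<in>carrier W. (\<lambda>k. hnorm W (s k \<ominus> l)) \<longlonglongrightarrow> 0" using w(1) by blast
next
  fix x assume x: "x \<in> carrier W" "x \<noteq> \<zero>"
  then obtain k where k: "coord x k \<noteq> 0" using coord_eqI[OF x(1) zero_in] coord_zero by auto
  then have "k \<in> I" using support[OF coord_in[OF x(1)]] by blast
  then have "0 < (\<Sum>k\<in>I. (cmod (coord x k))\<^sup>2)"
    using k finite_index by (intro sum_pos2[of _ k]) auto
  then show "0 < Re (cinner W x x)" by (simp add: cinner_self[OF x(1)])
next
  fix x y assume "x \<in> carrier W" "y \<in> carrier W"
  then show "cinner W y x = cnj (cinner W x y)" by (simp add: cinner_coord mult.commute)
qed (auto simp: cinner_coord add_in smult_in coord_add coord_smult sum.distrib sum_distrib_left algebra_simps)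

end

section \<open>The standard representation\<close>

lemma function_model_standard:
  "function_model {1..n} (carrier (standard_space n)) (standard_space n) (\<lambda>x. x)"
proof
  fix s :: "nat \<Rightarrow> nat \<Rightarrow> complex" and l
  assume s: "\<And>m. s m \<in> carrier (standard_space n)" and lim: "\<And>k. (\<lambda>m. s m k) \<longlonglongrightarrow> l k"
  have "l k = 0" if "k \<notin> {1..n}" for k
    using lim[of k] s that by (auto simp: standard_space_def Cn_def LIMSEQ_const_iff)
  moreover have "(\<Sum>k=1..n. l k) = 0"
  proof -
    have "(\<lambda>m. \<Sum>k=1..n. s m k) \<longlonglongrightarrow> (\<Sum>k=1..n. l k)" by (intro tendsto_sum lim)
    moreover have "(\<Sum>k=1..n. s m k) = 0" for m
      using s[of m] by (simp add: standard_space_def Cn_def if_distrib cong: if_cong)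
    ultimately show ?thesis by (simp add: LIMSEQ_const_iff)
  qed
  ultimately show "l \<in> carrier (standard_space n)"
    by (auto simp: standard_space_def Cn_def)
qed (auto simp: standard_space_def Cn_def bij_betw_def sum.distrib simp flip: sum_distrib_left)

lemma standard_space_sum:
  assumes "x \<in> carrier (standard_space n)" shows "(\<Sum>k=1..n. x k) = 0"
  using assms by (auto simp: standard_space_def Cn_def)

lemma transpose_sum_diff:
  fixes x :: "'i \<Rightarrow> complex"
  assumes I: "finite I" "a \<in> I" "b \<in> I" "a \<noteq> b"
  shows "(\<Sum>k\<in>I. (cmod (x (Transposition.transpose a b k) - x k))\<^sup>2) = 2 * (cmod (x a - x b))\<^sup>2"
proof -
  have "(\<Sum>k\<in>I. (cmod (x (Transposition.transpose a b k) - x k))\<^sup>2)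
      = (\<Sum>k\<in>{a, b}. (cmod (x (Transposition.transpose a b k) - x k))\<^sup>2)"
    by (rule sum.mono_neutral_right) (use I in \<open>auto simp: transpose_def\<close>)
  then show ?thesis using I by (simp add: norm_minus_commute)
qed

text \<open>
  A vector \<open>x\<close> of the standard representation is a configuration of \<open>n\<close> points in the plane with
  centroid \<open>0\<close>, and the transposition of \<open>a\<close> and \<open>b\<close> moves it by \<open>sqrt 2 * \<bar>x a - x b\<bar>\<close>; so
  \<open>planar_max_distance\<close> applies.
\<close>

lemma standard_displacement:
  assumes n: "2 \<le> n" and x: "x \<in> carrier (standard_space n)" "hnorm (standard_space n) x = 1"
  shows "sqrt (6 / real n) \<le> (MAX q\<in>transpositions n. hnorm (standard_space n) (standard_rep n q x \<ominus>\<^bsub>standard_space n\<^esub> x))"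
proof -
  let ?W = "standard_space n" and ?t = "Transposition.transpose"
  interpret function_model "{1..n}" "carrier ?W" ?W "\<lambda>x. x" by (rule function_model_standard)
  let ?d = "\<lambda>q. hnorm ?W (standard_rep n q x \<ominus>\<^bsub>?W\<^esub> x)"
  have rep: "standard_rep n (?t a b) x \<in> carrier ?W"
      "standard_rep n (?t a b) x = (\<lambda>k. x (?t a b k))"
    if ab: "a \<in> {1..n}" "b \<in> {1..n}" for a b
  proof -
    show eq: "standard_rep n (?t a b) x = (\<lambda>k. x (?t a b k))"
      using x(1) by (simp add: standard_rep_def)
    have p: "?t a b permutes {1..n}" using ab by (simp add: permutes_swap_id)
    have "(\<Sum>k=1..n. x (?t a b k)) = (\<Sum>k=1..n. x k)"
      by (rule sum.reindex_bij_betw[OF permutes_imp_bij[OF p]])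
    moreover have "x (?t a b k) = 0" if "k \<notin> {1..n}" for k
      using support[OF x(1) that] ab that by (metis transpose_apply_other)
    ultimately show "standard_rep n (?t a b) x \<in> carrier ?W"
      using standard_space_sum[OF x(1)] unfolding eq by (simp add: standard_space_def Cn_def)
  qed
  have disp: "(?d (?t a b))\<^sup>2 = 2 * (cmod (x a - x b))\<^sup>2"
    if ab: "a \<in> {1..n}" "b \<in> {1..n}" "a \<noteq> b" for a b
  proof -
    have m: "standard_rep n (?t a b) x \<ominus>\<^bsub>?W\<^esub> x \<in> carrier ?W" using rep(1)[OF ab(1,2)] x by simp
    have "(?d (?t a b))\<^sup>2 = (\<Sum>k=1..n. (cmod (x (?t a b k) - x k))\<^sup>2)"
      using hnorm_coord[OF m] unfolding coord_minus[OF rep(1)[OF ab(1,2)] x(1)]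
      by (simp add: sum_nonneg fun_cong[OF rep(2)[OF ab(1,2)]])
    then show ?thesis using transpose_sum_diff[of "{1..n}" a b x] ab by simp
  qed
  define d where "d q = (if q \<in> transpositions n then ?d q else 0)" for q
  have d0: "0 \<le> d q" for q
  proof (cases "q \<in> transpositions n")
    case True
    then obtain a b where q: "q = ?t a b" "a \<in> {1..n}" "b \<in> {1..n}" by (auto simp: transpositions_def)
    have "standard_rep n q x \<ominus>\<^bsub>?W\<^esub> x \<in> carrier ?W" using rep(1)[OF q(2,3)] x by (simp add: q(1))
    then show ?thesis using True by (simp add: d_def hnorm_coord sum_nonneg)
  qed (simp add: d_def)
  have eq: "d ` transpositions n = ?d ` transpositions n"
    by (intro image_cong refl) (auto simp: d_def)
  define M where "M = (MAX q\<in>transpositions n. d q)"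
  have M0: "0 \<le> M" unfolding M_def by (rule Max_displacement_nonneg[where d = d, OF n d0])
  have "(cmod (x a - x b))\<^sup>2 \<le> M\<^sup>2 / 2" if ab: "a \<in> {1..n}" "b \<in> {1..n}" for a b
  proof (cases "a = b")
    case False
    then have "d (?t a b) \<le> M" "?t a b \<in> transpositions n"
      unfolding M_def using displacement_le_Max[where d = d, OF n d0] ab
      by (auto simp: transpositions_def)
    then have "(?d (?t a b))\<^sup>2 \<le> M\<^sup>2" using d0[of "?t a b"] by (simp add: d_def power_mono)
    then show ?thesis using disp[OF ab False] by simp
  qed simp
  moreover have "(\<Sum>k=1..n. (cmod (x k))\<^sup>2) = 1" using x by (simp add: hnorm_coord)
  ultimately have "3 / real (card {1..n}) \<le> M\<^sup>2 / 2"
    using n by (intro planar_max_distance[of "{1..n}" x] standard_space_sum[OF x(1)]) auto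
  then have "6 / real n \<le> M\<^sup>2" by simp
  then have "sqrt (6 / real n) \<le> M" using M0 by (simp add: real_le_lsqrt)
  then show ?thesis by (simp only: M_def eq)
qed

lemma kazhdan_rep_standard_lower:
  assumes n: "2 \<le> n"
  shows "sqrt (6 / real n) \<le> kazhdan_rep (transpositions n) (standard_space n) (standard_rep n)"
proof -
  let ?W = "standard_space n"
  interpret M: function_model "{1..n}" "carrier ?W" ?W "\<lambda>x. x" by (rule function_model_standard)
  interpret hilbert_space ?W by (rule M.hilbert_space)
  define e :: "nat \<Rightarrow> complex" where "e = (\<lambda>k. if k = 1 then 1 else if k = 2 then - 1 else 0)"
  have "(\<Sum>k=1..n. e k) = (\<Sum>k\<in>{1, 2}. e k)"
    by (rule sum.mono_neutral_right) (use n in \<open>auto simp: e_def\<close>)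
  then have "e \<in> carrier ?W" using n by (auto simp: standard_space_def Cn_def e_def)
  moreover have "e \<noteq> \<zero>\<^bsub>?W\<^esub>"
    using M.coord_zero[of 1] by (auto simp: e_def dest: fun_cong[of _ _ "1 :: nat"])
  ultimately have "\<exists>v\<in>carrier ?W. hnorm ?W v = 1" by (intro exists_unit_vector) auto
  then show ?thesis unfolding kazhdan_rep_def
    by (intro cINF_greatest) (use standard_displacement[OF n] in auto)
qed

section \<open>A representation that attains the bound\<close>

lemma group_actionI:
  assumes G: "group G"
    and closed: "\<And>g x. g \<in> carrier G \<Longrightarrow> x \<in> E \<Longrightarrow> R g x \<in> E"
    and ext: "\<And>g. g \<in> carrier G \<Longrightarrow> R g \<in> extensional E"
    and one: "\<And>x. x \<in> E \<Longrightarrow> R \<one>\<^bsub>G\<^esub> x = x"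
    and mult: "\<And>g h x. g \<in> carrier G \<Longrightarrow> h \<in> carrier G \<Longrightarrow> x \<in> E \<Longrightarrow> R (g \<otimes>\<^bsub>G\<^esub> h) x = R g (R h x)"
  shows "group_action G E R"
proof -
  interpret G: group G by fact
  have bij: "R g \<in> Bij E" if g: "g \<in> carrier G" for g
  proof -
    have "bij_betw (R g) E E"
    proof (rule bij_betw_byWitness[where f' = "R (inv\<^bsub>G\<^esub> g)"])
      show "\<forall>x\<in>E. R (inv\<^bsub>G\<^esub> g) (R g x) = x" "\<forall>x\<in>E. R g (R (inv\<^bsub>G\<^esub> g) x) = x"
        using g one by (simp_all flip: mult)
    qed (use g closed in auto)
    then show ?thesis using ext[OF g] by (simp add: Bij_def)
  qed
  have "R (g \<otimes>\<^bsub>G\<^esub> h) = compose E (R g) (R h)" if "g \<in> carrier G" "h \<in> carrier G" for g h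
    using that ext[of "g \<otimes>\<^bsub>G\<^esub> h"] mult by (intro extensionalityI[of _ E]) (auto simp: compose_eq)
  then have "R \<in> hom G (BijGroup E)"
    using bij by (auto simp: hom_def BijGroup_def)
  then show ?thesis
    using G by (simp add: group_action_def group_hom_def group_hom_axioms_def group_BijGroup)
qed

text \<open>
  An infinite set is equipotent to its square, so the values can be packed into one complex number
  one at a time.
\<close>

lemma finite_support_functions_inj:
  assumes "finite I"
  shows "\<exists>\<phi> :: ('i \<Rightarrow> complex) \<Rightarrow> complex. inj_on \<phi> {x. \<forall>k. k \<notin> I \<longrightarrow> x k = 0}"
  using assms
proof (induction I rule: finite_induct)
  case empty
  then show ?case by (auto simp: inj_on_def fun_eq_iff)
next
  case (insert z I)
  then obtain \<phi> :: "('i \<Rightarrow> complex) \<Rightarrow> complex" where \<phi>: "inj_on \<phi> {x. \<forall>k. k \<notin> I \<longrightarrow> x k = 0}" by blast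
  have "infinite (UNIV :: complex set)" by (rule infinite_UNIV_char_0)
  then have "(card_of ((UNIV :: complex set) \<times> (UNIV :: complex set)), card_of (UNIV :: complex set)) \<in> ordIso"
    by (rule card_of_Times_same_infinite)
  then obtain p :: "complex \<times> complex \<Rightarrow> complex" where p: "inj p"
    by (auto simp: bij_betw_def simp flip: card_of_ordIso)
  have "inj_on (\<lambda>x. p (x z, \<phi> (x(z := 0)))) {x. \<forall>k. k \<notin> insert z I \<longrightarrow> x k = 0}"
  proof (rule inj_onI)
    fix x y :: "'i \<Rightarrow> complex"
    assume x: "x \<in> {x. \<forall>k. k \<notin> insert z I \<longrightarrow> x k = 0}" and y: "y \<in> {x. \<forall>k. k \<notin> insert z I \<longrightarrow> x k = 0}"
      and eq: "p (x z, \<phi> (x(z := 0))) = p (y z, \<phi> (y(z := 0)))"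
    have xz: "x z = y z" and "\<phi> (x(z := 0)) = \<phi> (y(z := 0))" using eq p by (auto dest: injD)
    then have "x(z := 0) = y(z := 0)" using \<phi> x y by (auto dest!: inj_onD)
    then show "x = y" using xz by (metis fun_upd_triv fun_upd_upd)
  qed
  then show ?case by blast
qed

text \<open>
  The columns of such a matrix are vectors of the standard representation, so the space is
  \<open>n\<close> copies of it; its rows are the points of a configuration in \<open>\<complex>\<^sup>n\<close> with centroid \<open>0\<close>.
\<close>

definition column_matrices :: "nat \<Rightarrow> (nat \<times> nat \<Rightarrow> complex) set" where
  "column_matrices n = {x. (\<forall>k. k \<notin> {1..n} \<times> {1..n} \<longrightarrow> x k = 0) \<and> (\<forall>j\<in>{1..n}. (\<Sum>i=1..n. x (i, j)) = 0)}"

definition matrix_space :: "nat \<Rightarrow> ((nat \<times> nat \<Rightarrow> complex) \<Rightarrow> 'v) \<Rightarrow> 'v hilbert" where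
  "matrix_space n \<phi> = (let \<psi> = inv_into (column_matrices n) \<phi> in
    \<lparr>carrier = \<phi> ` column_matrices n, monoid.mult = undefined, one = undefined,
     ring.zero = \<phi> (\<lambda>k. 0), add = (\<lambda>x y. \<phi> (\<lambda>k. \<psi> x k + \<psi> y k)),
     module.smult = (\<lambda>c x. \<phi> (\<lambda>k. c * \<psi> x k)),
     cinner = (\<lambda>x y. \<Sum>k\<in>{1..n} \<times> {1..n}. \<psi> x k * cnj (\<psi> y k))\<rparr>)"

definition permute_rows :: "(nat \<Rightarrow> nat) \<Rightarrow> (nat \<times> nat \<Rightarrow> complex) \<Rightarrow> nat \<times> nat \<Rightarrow> complex" where
  "permute_rows p x = (\<lambda>(i, j). x (Hilbert_Choice.inv p i, j))"

definition matrix_rep :: "nat \<Rightarrow> ((nat \<times> nat \<Rightarrow> complex) \<Rightarrow> 'v) \<Rightarrow> (nat \<Rightarrow> nat) \<Rightarrow> 'v \<Rightarrow> 'v" where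
  "matrix_rep n \<phi> p = (\<lambda>w\<in>\<phi> ` column_matrices n. \<phi> (permute_rows p (inv_into (column_matrices n) \<phi> w)))"

lemma permute_rows_in:
  assumes p: "p permutes {1..n}" and x: "x \<in> column_matrices n"
  shows "permute_rows p x \<in> column_matrices n"
proof -
  have p': "Hilbert_Choice.inv p permutes {1..n}" using p by (rule permutes_inv)
  have "x (Hilbert_Choice.inv p i, j) = 0" if "(i, j) \<notin> {1..n} \<times> {1..n}" for i j
    using x that permutes_in_image[OF p', of i] by (auto simp: column_matrices_def)
  moreover have "(\<Sum>i=1..n. x (Hilbert_Choice.inv p i, j)) = (\<Sum>i=1..n. x (i, j))" for j
    by (rule sum.reindex_bij_betw[OF permutes_imp_bij[OF p']])
  ultimately show ?thesis using x by (auto simp: column_matrices_def permute_rows_def)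
qed

lemma function_model_matrix:
  fixes \<phi> :: "(nat \<times> nat \<Rightarrow> complex) \<Rightarrow> 'v"
  assumes \<phi>: "inj_on \<phi> (column_matrices n)"
  shows "function_model ({1..n} \<times> {1..n}) (column_matrices n) (matrix_space n \<phi>) (inv_into (column_matrices n) \<phi>)"
proof -
  let ?S = "column_matrices n"
  have z: "(\<lambda>k. 0) \<in> ?S" by (simp add: column_matrices_def)
  have a: "(\<lambda>k. x k + y k) \<in> ?S" if "x \<in> ?S" "y \<in> ?S" for x y
    using that by (auto simp: column_matrices_def sum.distrib)
  have s: "(\<lambda>k. c * x k) \<in> ?S" if "x \<in> ?S" for x c
    using that by (auto simp: column_matrices_def simp flip: sum_distrib_left)
  have supp: "x k = 0" if "x \<in> ?S" "k \<notin> {1..n} \<times> {1..n}" for x k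
    using that unfolding column_matrices_def by blast
  show ?thesis
  proof
    fix s :: "nat \<Rightarrow> nat \<times> nat \<Rightarrow> complex" and l
    assume s: "\<And>m. s m \<in> ?S" and lim: "\<And>k. (\<lambda>m. s m k) \<longlonglongrightarrow> l k"
    have "l k = 0" if "k \<notin> {1..n} \<times> {1..n}" for k
    proof -
      have "s m k = 0" for m using s[of m] that unfolding column_matrices_def by blast
      then show ?thesis using lim[of k] by (simp add: LIMSEQ_const_iff)
    qed
    moreover have "(\<Sum>i=1..n. l (i, j)) = 0" if j: "j \<in> {1..n}" for j
    proof -
      have "(\<lambda>m. \<Sum>i=1..n. s m (i, j)) \<longlonglongrightarrow> (\<Sum>i=1..n. l (i, j))" by (intro tendsto_sum lim)
      moreover have "(\<Sum>i=1..n. s m (i, j)) = 0" for m using s[of m] j by (simp add: column_matrices_def)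
      ultimately show ?thesis by (simp add: LIMSEQ_const_iff)
    qed
    ultimately show "l \<in> ?S" by (simp add: column_matrices_def)
  next
    show "bij_betw (inv_into ?S \<phi>) (carrier (matrix_space n \<phi>)) ?S"
      using bij_betw_inv_into[OF inj_on_imp_bij_betw[OF \<phi>]] by (simp add: matrix_space_def Let_def)
  qed (use \<phi> z a s supp in \<open>auto simp: matrix_space_def Let_def\<close>)
qed

lemma unitary_rep_matrix:
  fixes \<phi> :: "(nat \<times> nat \<Rightarrow> complex) \<Rightarrow> 'v"
  assumes \<phi>: "inj_on \<phi> (column_matrices n)"
  shows "unitary_rep (sym_group n) (matrix_space n \<phi>) (matrix_rep n \<phi>)"
proof -
  let ?S = "column_matrices n" and ?W = "matrix_space n \<phi>" and ?R = "matrix_rep n \<phi>" and ?\<psi> = "inv_into (column_matrices n) \<phi>"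
  interpret M: function_model "{1..n} \<times> {1..n}" ?S ?W ?\<psi> by (rule function_model_matrix[OF \<phi>])
  have car: "carrier ?W = \<phi> ` ?S" by (simp add: matrix_space_def Let_def)
  have R_in: "?R p w \<in> carrier ?W" and coord_R: "?\<psi> (?R p w) = permute_rows p (?\<psi> w)"
    if p: "p permutes {1..n}" and w: "w \<in> carrier ?W" for p w
  proof -
    have "permute_rows p (?\<psi> w) \<in> ?S" using p M.coord_in[OF w] by (rule permute_rows_in)
    moreover have "?R p w = \<phi> (permute_rows p (?\<psi> w))" using w by (simp add: matrix_rep_def car)
    ultimately show "?R p w \<in> carrier ?W" "?\<psi> (?R p w) = permute_rows p (?\<psi> w)"
      using \<phi> by (simp_all add: car)
  qed
  have act: "group_action (sym_group n) (carrier ?W) ?R"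
  proof (rule group_actionI)
    show "?R (p \<otimes>\<^bsub>sym_group n\<^esub> q) w = ?R p (?R q w)"
      if pq: "p \<in> carrier (sym_group n)" "q \<in> carrier (sym_group n)" and w: "w \<in> carrier ?W" for p q w
    proof -
      have p: "p permutes {1..n}" and q: "q permutes {1..n}" using pq by (auto simp: sym_group_def)
      have pq': "p \<circ> q permutes {1..n}" using p q by (rule permutes_compose[rotated])
      have inv: "Hilbert_Choice.inv (p \<circ> q) = Hilbert_Choice.inv q \<circ> Hilbert_Choice.inv p"
        using p q by (intro o_inv_distrib) (auto simp: permutes_bij)
      have "?R (p \<circ> q) w = ?R p (?R q w)"
        by (rule M.coord_eqI) (simp_all add: R_in coord_R p q pq' w permute_rows_def inv split: prod.split del: One_nat_def)
      then show ?thesis by (simp add: sym_group_mult)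
    qed
    show "?R \<one>\<^bsub>sym_group n\<^esub> w = w" if "w \<in> carrier ?W" for w
      by (rule M.coord_eqI)
        (simp_all add: sym_group_one R_in coord_R permutes_id that permute_rows_def split: prod.split del: One_nat_def)
    show "Group.group (sym_group n)" by (rule sym_group_is_group)
    show "?R p w \<in> carrier ?W" if "p \<in> carrier (sym_group n)" "w \<in> carrier ?W" for p w
      using that by (intro R_in) (auto simp: sym_group_def)
    show "?R p \<in> extensional (carrier ?W)" for p by (simp add: matrix_rep_def car)
  qed
  show ?thesis
  proof (intro unitary_rep.intro unitary_rep_axioms.intro M.hilbert_space act)
    fix p x y assume p: "p \<in> carrier (sym_group n)" and x: "x \<in> carrier ?W" and y: "y \<in> carrier ?W"
    have p': "p permutes {1..n}" using p by (simp add: sym_group_def)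
    show "?R p (x \<oplus>\<^bsub>?W\<^esub> y) = ?R p x \<oplus>\<^bsub>?W\<^esub> ?R p y"
      by (rule M.coord_eqI)
        (simp_all add: R_in coord_R p' x y M.add_in M.coord_add permute_rows_def split: prod.split del: One_nat_def)
    have b: "bij_betw (\<lambda>(i, j). (Hilbert_Choice.inv p i, j)) ({1..n} \<times> {1..n}) ({1..n} \<times> {1..n})"
      using bij_betw_map_prod[OF permutes_imp_bij[OF permutes_inv[OF p']] bij_betw_id[of "{1..n}"]]
      by (simp add: map_prod_def id_def)
    show "cinner ?W (?R p x) (?R p y) = cinner ?W x y"
      using sum.reindex_bij_betw[OF b, of "\<lambda>k. ?\<psi> x k * cnj (?\<psi> y k)"]
      by (simp add: M.cinner_coord R_in coord_R p' x y permute_rows_def case_prod_unfold del: One_nat_def)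
  next
    fix p x c assume p: "p \<in> carrier (sym_group n)" and x: "x \<in> carrier ?W"
    have p': "p permutes {1..n}" using p by (simp add: sym_group_def)
    show "?R p (c \<odot>\<^bsub>?W\<^esub> x) = c \<odot>\<^bsub>?W\<^esub> ?R p x"
      by (rule M.coord_eqI)
        (simp_all add: R_in coord_R p' x M.smult_in M.coord_smult permute_rows_def split: prod.split del: One_nat_def)
  qed
qed

text \<open>
  The rows are the vertices \<open>e\<^sub>i - (1 / n) \<Sum>\<^sub>j e\<^sub>j\<close> of a regular simplex, divided by
  \<open>sqrt (n - 1)\<close> to obtain a unit vector.
\<close>

definition simplex_matrix :: "nat \<Rightarrow> nat \<times> nat \<Rightarrow> complex" where
  "simplex_matrix n = (\<lambda>(i, j). if i \<in> {1..n} \<and> j \<in> {1..n}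
    then complex_of_real (((if i = j then 1 else 0) - 1 / real n) / sqrt (real n - 1)) else 0)"

lemma
  assumes n: "2 \<le> n"
  shows simplex_matrix_in: "simplex_matrix n \<in> column_matrices n"
    and simplex_matrix_unit: "(\<Sum>k\<in>{1..n} \<times> {1..n}. (cmod (simplex_matrix n k))\<^sup>2) = 1"
    and simplex_matrix_displacement: "a \<in> {1..n} \<Longrightarrow> b \<in> {1..n} \<Longrightarrow> a \<noteq> b \<Longrightarrow>
      (\<Sum>k\<in>{1..n} \<times> {1..n}. (cmod (permute_rows (Transposition.transpose a b) (simplex_matrix n) k
         - simplex_matrix n k))\<^sup>2) = 4 / (real n - 1)"
proof -
  let ?w = "simplex_matrix n"
  define r where "r i j = ((if i = j then 1 else 0) - 1 / real n) / sqrt (real n - 1)" for i j :: nat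
  have w: "?w (i, j) = complex_of_real (r i j)" if "i \<in> {1..n}" "j \<in> {1..n}" for i j
    using that by (simp add: simplex_matrix_def r_def)
  have n1: "real n - 1 > 0" "real n > 0" using n by auto
  have row: "(\<Sum>i=1..n. r i j) = 0" if "j \<in> {1..n}" for j
  proof -
    have "(\<Sum>i=1..n. (if i = j then 1 else 0) - 1 / real n) = 0"
      using that n by (simp add: sum_subtractf)
    then show ?thesis by (simp add: r_def flip: sum_divide_distrib)
  qed
  have "(\<Sum>i=1..n. ?w (i, j)) = 0" if j: "j \<in> {1..n}" for j
  proof -
    have "(\<Sum>i=1..n. ?w (i, j)) = (\<Sum>i=1..n. complex_of_real (r i j))"
      by (rule sum.cong[OF refl w[OF _ j]])
    then show ?thesis using row[OF j] by (simp flip: of_real_sum)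
  qed
  moreover have "?w k = 0" if "k \<notin> {1..n} \<times> {1..n}" for k
    using that by (cases k) (auto simp: simplex_matrix_def)
  ultimately show "?w \<in> column_matrices n" unfolding column_matrices_def by blast
  have sq: "(r i j)\<^sup>2 = ((if i = j then 1 - 2 / real n else 0) + 1 / (real n)\<^sup>2) / (real n - 1)" for i j
    using n1 by (simp add: r_def power_divide power2_diff)
  have norm: "(\<Sum>j=1..n. (r i j)\<^sup>2) = (1 - 1 / real n) / (real n - 1)" if i: "i \<in> {1..n}" for i
  proof -
    have "(\<Sum>j=1..n. (if i = j then 1 - 2 / real n else 0) + 1 / (real n)\<^sup>2) = 1 - 1 / real n"
      using i n by (simp add: sum.distrib power2_eq_square)
    then show ?thesis by (simp add: sq flip: sum_divide_distrib)
  qed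
  have "(\<Sum>k\<in>{1..n} \<times> {1..n}. (cmod (?w k))\<^sup>2) = (\<Sum>i=1..n. \<Sum>j=1..n. (r i j)\<^sup>2)"
    unfolding sum.cartesian_product by (rule sum.cong) (auto simp: w simp del: One_nat_def)
  also have "\<dots> = (\<Sum>i=1..n. (1 - 1 / real n) / (real n - 1))"
    by (rule sum.cong[OF refl norm])
  also have "\<dots> = 1" using n1 by (simp add: field_simps)
  finally show "(\<Sum>k\<in>{1..n} \<times> {1..n}. (cmod (?w k))\<^sup>2) = 1" .
  show "(\<Sum>k\<in>{1..n} \<times> {1..n}. (cmod (permute_rows (Transposition.transpose a b) ?w k - ?w k))\<^sup>2) = 4 / (real n - 1)"
    if ab: "a \<in> {1..n}" "b \<in> {1..n}" "a \<noteq> b"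
  proof -
    let ?t = "Transposition.transpose a b"
    have "(\<Sum>k\<in>{1..n} \<times> {1..n}. (cmod (permute_rows ?t ?w k - ?w k))\<^sup>2)
        = (\<Sum>j=1..n. \<Sum>i=1..n. (cmod (?w (?t i, j) - ?w (i, j)))\<^sup>2)"
      by (subst sum.swap) (simp add: sum.cartesian_product permute_rows_def case_prod_unfold)
    also have "\<dots> = (\<Sum>j=1..n. 2 * (cmod (?w (a, j) - ?w (b, j)))\<^sup>2)"
      by (intro sum.cong refl transpose_sum_diff[of "{1..n}" a b "\<lambda>i. ?w (i, _)"]) (use ab in auto)
    also have "\<dots> = (\<Sum>j=1..n. ((if j = a then 2 else 0) + (if j = b then 2 else 0)) / (real n - 1))"
    proof (rule sum.cong, rule refl)
      fix j assume j: "j \<in> {1..n}"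
      have "r a j - r b j = ((if a = j then 1 else 0) - (if b = j then 1 else 0)) / sqrt (real n - 1)"
        by (simp add: r_def diff_divide_distrib)
      then have "2 * (r a j - r b j)\<^sup>2 = ((if j = a then 2 else 0) + (if j = b then 2 else 0)) / (real n - 1)"
        using n1 ab by (auto simp: power_divide)
      then show "2 * (cmod (?w (a, j) - ?w (b, j)))\<^sup>2 = ((if j = a then 2 else 0) + (if j = b then 2 else 0)) / (real n - 1)"
        using w[OF ab(1) j] w[OF ab(2) j] by (simp flip: of_real_diff)
    qed
    also have "\<dots> = 4 / (real n - 1)"
      using ab by (simp add: sum.distrib flip: sum_divide_distrib)
    finally show ?thesis .
  qed
qed

text \<open>
  A matrix fixed by all permutations of its rows has constant columns, which vanish because
  their sums do. The regular simplex is moved equally far by all transpositions.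
\<close>

lemma matrix_rep_attains:
  fixes \<phi> :: "(nat \<times> nat \<Rightarrow> complex) \<Rightarrow> 'v"
  assumes n: "2 \<le> n" and \<phi>: "inj_on \<phi> (column_matrices n)"
  shows "(matrix_space n \<phi>, matrix_rep n \<phi>) \<in> reps_without_invariants (sym_group n)"
    and "kazhdan_rep (transpositions n) (matrix_space n \<phi>) (matrix_rep n \<phi>) \<le> 2 / sqrt (real n - 1)"
proof -
  let ?S = "column_matrices n" and ?W = "matrix_space n \<phi>" and ?R = "matrix_rep n \<phi>" and ?\<psi> = "inv_into (column_matrices n) \<phi>"
  let ?t = "Transposition.transpose :: nat \<Rightarrow> nat \<Rightarrow> nat \<Rightarrow> nat"
  interpret M: function_model "{1..n} \<times> {1..n}" ?S ?W ?\<psi> by (rule function_model_matrix[OF \<phi>])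
  interpret U: unitary_rep "sym_group n" ?W ?R by (rule unitary_rep_matrix[OF \<phi>])
  have car: "carrier ?W = \<phi> ` ?S" by (simp add: matrix_space_def Let_def)
  have coord_R: "?\<psi> (?R p w) = permute_rows p (?\<psi> w)"
    if p: "p permutes {1..n}" and w: "w \<in> carrier ?W" for p w
    using w permute_rows_in[OF p M.coord_in[OF w]] \<phi> by (simp add: matrix_rep_def car)
  have t: "?t a b permutes {1..n}" if "a \<in> {1..n}" "b \<in> {1..n}" for a b
    using that by (simp add: permutes_swap_id)
  have noinv: "v = \<zero>\<^bsub>?W\<^esub>" if v: "v \<in> carrier ?W" and inv: "\<forall>g\<in>carrier (sym_group n). ?R g v = v" for v
  proof (rule M.coord_eqI[OF v M.zero_in])
    have row: "?\<psi> v (a, j) = ?\<psi> v (b, j)" if ab: "a \<in> {1..n}" "b \<in> {1..n}" for a b j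
    proof -
      have "permute_rows (?t a b) (?\<psi> v) = ?\<psi> v"
        using inv coord_R[OF t[OF ab] v] t[OF ab] by (simp add: sym_group_def)
      from fun_cong[OF this, of "(b, j)"] show ?thesis by (simp add: permute_rows_def)
    qed
    have "?\<psi> v k = 0" for k
    proof (cases "k \<in> {1..n} \<times> {1..n}")
      case True
      then obtain i j where k: "k = (i, j)" "i \<in> {1..n}" "j \<in> {1..n}" by auto
      have "(\<Sum>a=1..n. ?\<psi> v (a, j)) = (\<Sum>a=1..n. ?\<psi> v (i, j))"
        by (rule sum.cong[OF refl row[OF _ k(2)]])
      moreover have "(\<Sum>a=1..n. ?\<psi> v (a, j)) = 0"
        using M.coord_in[OF v] k(3) by (simp add: column_matrices_def)
      ultimately show ?thesis using n k by simp
    qed (use M.support[OF M.coord_in[OF v]] in blast)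
    then show "?\<psi> v k = ?\<psi> \<zero>\<^bsub>?W\<^esub> k" for k by (simp only: M.coord_zero)
  qed
  define x where "x = simplex_matrix n"
  have x: "x \<in> ?S" "(\<Sum>k\<in>{1..n} \<times> {1..n}. (cmod (x k))\<^sup>2) = 1"
    and xt: "\<And>a b. a \<in> {1..n} \<Longrightarrow> b \<in> {1..n} \<Longrightarrow> a \<noteq> b \<Longrightarrow>
      (\<Sum>k\<in>{1..n} \<times> {1..n}. (cmod (permute_rows (?t a b) x k - x k))\<^sup>2) = 4 / (real n - 1)"
    unfolding x_def
    by (rule simplex_matrix_in[OF n] simplex_matrix_unit[OF n] simplex_matrix_displacement[OF n]; assumption?)+
  define v where "v = \<phi> x"
  have v: "v \<in> carrier ?W" "?\<psi> v = x" using x \<phi> by (simp_all add: v_def car)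
  have hv: "hnorm ?W v = 1" using x v by (simp add: M.hnorm_coord)
  have "v \<noteq> \<zero>\<^bsub>?W\<^esub>" using hv M.hnorm_coord[OF M.zero_in] by (auto simp: M.coord_zero)
  then show "(?W, ?R) \<in> reps_without_invariants (sym_group n)"
    using noinv v(1) U.unitary_rep_axioms by (auto simp: reps_without_invariants_def)
  have disp: "hnorm ?W (?R q v \<ominus>\<^bsub>?W\<^esub> v) = 2 / sqrt (real n - 1)" if q0: "q \<in> transpositions n" for q
  proof -
    obtain a b where q: "q = ?t a b" "a \<in> {1..n}" "b \<in> {1..n}" "a \<noteq> b"
      using q0 unfolding transpositions_def by blast
    have qp: "q permutes {1..n}" using t q by simp
    have Rv: "?R q v \<in> carrier ?W" using U.rep_closed[of q v] qp v by (simp add: sym_group_def)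
    have m: "?R q v \<ominus>\<^bsub>?W\<^esub> v \<in> carrier ?W" using Rv v by simp
    have "hnorm ?W (?R q v \<ominus>\<^bsub>?W\<^esub> v) = sqrt (4 / (real n - 1))"
      using M.hnorm_coord[OF m] xt[OF q(2-4), folded q(1)]
      unfolding M.coord_minus[OF Rv v(1)] coord_R[OF qp v(1)] v(2) by simp
    then show ?thesis by (simp add: real_sqrt_divide)
  qed
  have "1 \<in> {1..n}" "2 \<in> {1..n}" "1 \<noteq> (2 :: nat)" using n by auto
  then have "?t 1 2 \<in> transpositions n" unfolding transpositions_def by blast
  then have "(\<lambda>q. hnorm ?W (?R q v \<ominus>\<^bsub>?W\<^esub> v)) ` transpositions n = {2 / sqrt (real n - 1)}"
    using disp by auto
  then have max: "(MAX q\<in>transpositions n. hnorm ?W (?R q v \<ominus>\<^bsub>?W\<^esub> v)) = 2 / sqrt (real n - 1)" by simp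
  have "bdd_below ((\<lambda>v. MAX q\<in>transpositions n. hnorm ?W (?R q v \<ominus>\<^bsub>?W\<^esub> v)) ` {v \<in> carrier ?W. hnorm ?W v = 1})"
    using reps_displacement_Max[OF n \<open>(?W, ?R) \<in> _\<close>] by (intro bdd_belowI2[of _ "2 / sqrt (real n - 1)"]) auto
  then show "kazhdan_rep (transpositions n) ?W ?R \<le> 2 / sqrt (real n - 1)"
    unfolding kazhdan_rep_def using v hv max by (intro cINF_lower2[where x = v]) auto
qed

section \<open>The Kazhdan constant of the transpositions\<close>

lemma kazhdan_constant_transpositions:
  fixes f :: "complex \<Rightarrow> 'v"
  assumes n: "2 \<le> n" and f: "inj f"
  shows "kazhdan_constant TYPE('v) (sym_group n) (transpositions n) = 2 / sqrt (real n - 1)"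
proof -
  let ?Q = "transpositions n" and ?c = "2 / sqrt (real n - 1)"
  let ?X = "reps_without_invariants (sym_group n) :: ('v hilbert \<times> ((nat \<Rightarrow> nat) \<Rightarrow> 'v \<Rightarrow> 'v)) set"
  let ?k = "\<lambda>(V :: 'v hilbert, R). kazhdan_rep ?Q V R"
  have lower: "?c \<le> ?k p" if "p \<in> ?X" for p
    using that kazhdan_rep_lower[OF n] by (cases p) auto
  obtain \<phi> :: "(nat \<times> nat \<Rightarrow> complex) \<Rightarrow> complex"
    where "inj_on \<phi> {x. \<forall>k. k \<notin> {1..n} \<times> {1..n} \<longrightarrow> x k = 0}"
    using finite_support_functions_inj[of "{1..n} \<times> {1..n}"] by auto
  then have "inj_on \<phi> (column_matrices n)" by (rule inj_on_subset) (auto simp: column_matrices_def)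
  then have inj: "inj_on (f \<circ> \<phi>) (column_matrices n)"
    using f by (intro comp_inj_on) (auto intro: inj_on_subset)
  note ex = matrix_rep_attains[OF n inj]
  have "(INF p\<in>?X. ?k p) \<le> ?c"
    using ex lower by (intro cINF_lower2[where x = "(matrix_space n (f \<circ> \<phi>), matrix_rep n (f \<circ> \<phi>))"] bdd_belowI2[of _ ?c]) auto
  moreover have "?c \<le> (INF p\<in>?X. ?k p)"
    using ex(1) lower by (intro cINF_greatest) auto
  ultimately show ?thesis unfolding kazhdan_constant_def by (rule antisym)
qed

theorem proposition5p2:
  fixes n :: nat
  assumes "n \<ge> 4"
    and "\<exists>f :: complex \<Rightarrow> 'v. inj f"
  shows "kazhdan_constant TYPE('v) (sym_group n) (transpositions n) = 2 / sqrt (real n - 1)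
      \<and> kazhdan_constant TYPE('v) (sym_group n) (transpositions n)
        < kazhdan_rep (transpositions n) (standard_space n) (standard_rep n)"
proof -
  obtain f :: "complex \<Rightarrow> 'v" where "inj f" using assms(2) by blast
  then have eq: "kazhdan_constant TYPE('v) (sym_group n) (transpositions n) = 2 / sqrt (real n - 1)"
    using assms(1) by (intro kazhdan_constant_transpositions) auto
  have "4 / (real n - 1) < 6 / real n" using assms(1) by (simp add: field_simps)
  then have "sqrt (4 / (real n - 1)) < sqrt (6 / real n)" by simp
  then have "2 / sqrt (real n - 1) < sqrt (6 / real n)" by (simp add: real_sqrt_divide)
  also have "\<dots> \<le> kazhdan_rep (transpositions n) (standard_space n) (standard_rep n)"
    using assms(1) by (intro kazhdan_rep_standard_lower) simp
  finally show ?thesis using eq by simp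
qed

end
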